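(* For every integer $n\ge 0$, $$\mathrm{SODO}(5n)\equiv 0 \pmod 5,$$ $$\mathrm{SODO}(7n)\equiv 0 \pmod 7,$$ $$\mathrm{SODO}(7n+2)\equiv 0 \pmod 7.$$
   Context: A partition of $n$ without repeated odd parts is a partition of $n$ in which each odd part occurs at most once (even parts may be repeated without restriction). $\mathrm{SODO}(n)$ denotes the sum of all the odd parts in all the partitions of $n$ without repeated odd parts. *)

theory Defs
  imports "HOL-Library.Multiset" "HOL-Number_Theory.Cong"
begin

definition is_partition :: "nat multiset \<Rightarrow> nat \<Rightarrow> bool" where
  "is_partition P n \<longleftrightarrow> (\<forall>k \<in># P. k > 0) \<and> sum_mset P = n"

definition partitions_no_rep_odd :: "nat \<Rightarrow> nat multiset set" where
  "partitions_no_rep_odd n = {P. is_partition P n \<and> (\<forall>k. odd k \<longrightarrow> count P k \<le> 1)}"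

definition SODO :: "nat \<Rightarrow> nat" where
  "SODO n = (\<Sum>P \<in> partitions_no_rep_odd n. sum_mset (filter_mset odd P))"

(* Finiteness ensures that the sum defining SODO is not the default value 0. *)
lemma finite_partitions_no_rep_odd: "finite (partitions_no_rep_odd n)"
proof (rule finite_subset)
  show "finite (\<Union>s\<in>{..n}. multisets_of_size {..n} s)"
    by (intro finite_UN_I finite_multisets_of_size) auto
  show "partitions_no_rep_odd n \<subseteq> (\<Union>s\<in>{..n}. multisets_of_size {..n} s)"
  proof
    fix P assume "P \<in> partitions_no_rep_odd n"
    then have pos: "\<And>k. k \<in># P \<Longrightarrow> k > 0" and sum: "sum_mset P = n"
      by (auto simp: partitions_no_rep_odd_def is_partition_def)
    have "size P \<le> sum_mset P" using pos
    proof (induction P)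
      case (add x P)
      have "size P \<le> sum_mset P" by (rule add.IH) (simp add: add.prems)
      moreover have "x > 0" by (rule add.prems) simp
      ultimately show ?case by simp
    qed simp
    moreover have "set_mset P \<subseteq> {..n}"
      using sum by (auto dest!: multi_member_split)
    ultimately show "P \<in> (\<Union>s\<in>{..n}. multisets_of_size {..n} s)"
      using sum by (auto simp: multisets_of_size_def)
  qed
qed

end

theory Submission
  imports Defs "HOL-Computational_Algebra.Formal_Power_Series" "HOL-Computational_Algebra.Polynomial"
begin

text \<open>
  Write \<open>E\<^sub>c = \<Prod>\<^sub>i\<^sub>\<ge>\<^sub>1 (1 - q\<^sup>c\<^sup>i)\<close>, \<open>O\<^sub>\<plusminus> = \<Prod>\<^sub>i\<^sub>\<ge>\<^sub>0 (1 \<plusminus> q\<^sup>2\<^sup>i\<^sup>+\<^sup>1)\<close>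
  and \<open>D = q d/dq\<close>. A partition without repeated odd parts is a set of odd numbers together with
  a multiset of even numbers, and the sum of the odd parts is the weight of the set, so
  \<open>\<Sum> SODO(n) q\<^sup>n = D(O\<^sub>+) / E\<^sub>2\<close>. Replacing \<open>q\<close> by \<open>-q\<close> only changes signs of coefficients and turns this into
  \<open>G = D(O\<^sub>-) / E\<^sub>2\<close> (lemma \<open>SODO_series_mult_euler\<close>), where now \<open>O\<^sub>- = E\<^sub>1 / E\<^sub>2\<close>.

  For a prime \<open>p\<close> the series \<open>E\<^sub>2\<^sup>p\<close> is, modulo \<open>p\<close>, a series in \<open>q\<^sup>p\<close> with constant term 1.
  Multiplication by it mixes only coefficients whose indices agree modulo \<open>p\<close>, so the coefficients
  of \<open>G\<close> in a residue class modulo \<open>p\<close> all vanish modulo \<open>p\<close> as soon as those of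
  \<open>G E\<^sub>2\<^sup>p = D(O\<^sub>-) E\<^sub>2\<^sup>p\<^sup>-\<^sup>1\<close> do (lemma \<open>dvd_SODO\<close>). The Leibniz rule writes these products as
  brackets of two theta series:

  \<^item> \<open>3 D(O\<^sub>-) E\<^sub>2\<^sup>4 = 3 D(E\<^sub>1) E\<^sub>2\<^sup>3 - E\<^sub>1 D(E\<^sub>2\<^sup>3)\<close>, with Euler's \<open>E\<^sub>1 = \<Sum> (-1)\<^sup>i q\<^bsup>i(3i+1)/2\<^esup>\<close>
    and Jacobi's \<open>2 E\<^sub>2\<^sup>3 = \<Sum> (-1)\<^sup>j (2j+1) q\<^bsup>j(j+1)\<^esup>\<close>;
  \<^item> \<open>5 D(O\<^sub>-) E\<^sub>2\<^sup>6 = D(E\<^sub>1\<^sup>3) Y - E\<^sub>1\<^sup>3 D(Y)\<close>, with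
    \<open>Y = E\<^sub>2\<^sup>5 / E\<^sub>1\<^sup>2 = \<Sum> (-1)\<^sup>k (3k+1) q\<^bsup>k(3k+2)\<^esup>\<close>.

  All sums run over the integers. The coefficient of \<open>q\<^sup>n\<close> in such a bracket is a sum over the pairs
  of exponents \<open>e + d = n\<close> of the two weights times \<open>3e - d\<close> or \<open>e - d\<close>. For the residues of
  \<open>n\<close> in the theorem every single term is divisible by \<open>p\<close>, which is a finite check on
  residues (lemmas \<open>dvd_5_quadratic\<close> and \<open>dvd_7_quadratic\<close>).

  Euler's series is a case of the Jacobi triple product and Jacobi's series is a derivative of it; both are
  obtained as limits of finite identities that follow from the \<open>q\<close>-binomial theorem. The series \<open>Y\<close> is a derivative of the quintuple product; it is reached without
  that product by comparing two double series, \<open>Y E\<^sub>4\<close> and \<open>(\<Sum> q\<^bsup>n\<^sup>2\<^esup>) E\<^sub>4\<^sup>3\<close>, through the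
  norm form of \<open>\<int>[\<surd>-2]\<close> (lemma \<open>ternary_exponent_sum\<close>).
\<close>

unbundle fps_syntax

section \<open>Gaussian binomials and finite theta identities\<close>

fun gauss_binom :: "'a::comm_ring_1 \<Rightarrow> nat \<Rightarrow> nat \<Rightarrow> 'a" where
  "gauss_binom q n 0 = 1"
| "gauss_binom q 0 (Suc k) = 0"
| "gauss_binom q (Suc n) (Suc k) = gauss_binom q n k + q ^ Suc k * gauss_binom q n (Suc k)"

text \<open>The \<open>q\<close>-Pochhammer symbol \<open>(q; q)\<^sub>n\<close>: Gaussian factorials without the denominators \<open>1 - q\<close>.\<close>

definition qfact :: "'a::comm_ring_1 \<Rightarrow> nat \<Rightarrow> 'a" where
  "qfact q n = (\<Prod>i<n. 1 - q ^ Suc i)"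

lemma qfact_0 [simp]: "qfact q 0 = 1"
  by (simp add: qfact_def)

lemma qfact_Suc: "qfact q (Suc n) = qfact q n * (1 - q ^ Suc n)"
  by (simp add: qfact_def)

lemma gauss_binom_eq_0: "n < k \<Longrightarrow> gauss_binom q n k = 0"
  by (induction q n k rule: gauss_binom.induct) auto

lemma gauss_binom_self [simp]: "gauss_binom q n n = 1"
  by (induction n) (auto simp: gauss_binom_eq_0)

text \<open>
  The product form, kept free of division so that it holds in every commutative ring; it is what
  controls the limit of the Gaussian binomials.
\<close>

lemma gauss_binom_mult_qfact:
  "gauss_binom q (m + k) k * (qfact q m * qfact q k) = qfact q (m + k)"
proof (induction "m + k" arbitrary: m k rule: less_induct)
  case less
  show ?case
  proof (cases m)
    case 0
    then show ?thesis by simp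
  next
    case (Suc m')
    show ?thesis
    proof (cases k)
      case 0
      then show ?thesis by simp
    next
      case (Suc k')
      note km = \<open>m = Suc m'\<close> \<open>k = Suc k'\<close>
      have 1: "gauss_binom q (m + k') k' * (qfact q m * qfact q k') = qfact q (m + k')"
        by (rule less) (simp add: km)
      have 2: "gauss_binom q (m' + k) k * (qfact q m' * qfact q k) = qfact q (m' + k)"
        by (rule less) (simp add: km)
      have e: "m + k' = m' + k" by (simp add: km)
      have "gauss_binom q (m + k) k * (qfact q m * qfact q k)
          = (gauss_binom q (m + k') k' * (qfact q m * qfact q k')) * (1 - q ^ k)
            + q ^ k * (gauss_binom q (m' + k) k * (qfact q m' * qfact q k)) * (1 - q ^ m)"
        by (simp add: km qfact_Suc algebra_simps)
      also have "\<dots> = qfact q (m' + k) * ((1 - q ^ k) + q ^ k * (1 - q ^ m))"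
        by (simp only: 1 2, simp only: e, simp add: algebra_simps)
      also have "(1 - q ^ k) + q ^ k * (1 - q ^ m) = 1 - q ^ (m + k)"
        by (simp add: algebra_simps power_add)
      also have "qfact q (m' + k) * (1 - q ^ (m + k)) = qfact q (m + k)"
        by (simp add: km qfact_Suc)
      finally show ?thesis .
    qed
  qed
qed

lemma choose_two_Suc: "Suc k choose 2 = (k choose 2) + k"
  by (simp add: numeral_2_eq_2)

text \<open>
  The \<open>q\<close>-binomial theorem. It is homogeneous in \<open>a\<close> and \<open>z\<close> because the applications need
  \<open>z / a = x q\<^sup>-\<^sup>n\<close>, and \<open>a = q\<^sup>n\<close> avoids the negative power. Splitting off the factor
  \<open>i = 0\<close> replaces \<open>z\<close> by \<open>z q\<close> in the rest, which is the recursion of the Gaussian binomials.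
\<close>

lemma rothe:
  fixes a z q :: "'a::comm_ring_1"
  shows "(\<Prod>i<n. a + z * q ^ i) = (\<Sum>k\<le>n. gauss_binom q n k * q ^ (k choose 2) * z ^ k * a ^ (n - k))"
proof (induction n arbitrary: z)
  case 0
  then show ?case by (simp add: numeral_2_eq_2)
next
  case (Suc n)
  let ?t = "\<lambda>k. gauss_binom q n k * q ^ (k choose 2) * (z * q) ^ k * a ^ (n - k)"
  have "(\<Prod>i<Suc n. a + z * q ^ i) = (a + z) * (\<Prod>i<n. a + (z * q) * q ^ i)"
    by (subst prod.lessThan_Suc_shift) (simp add: mult.assoc)
  also have "\<dots> = (a + z) * (\<Sum>k\<le>n. ?t k)"
    by (simp only: Suc)
  also have "\<dots> = (\<Sum>k\<le>n. a * ?t k) + (\<Sum>k\<le>n. z * ?t k)"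
    by (simp add: distrib_right sum_distrib_left sum.distrib)
  also have "(\<Sum>k\<le>n. a * ?t k) = a ^ Suc n + (\<Sum>k\<le>n. q ^ Suc k * gauss_binom q n (Suc k)
      * q ^ (Suc k choose 2) * z ^ Suc k * a ^ (n - k))"
  proof -
    have "(\<Sum>k\<le>n. a * ?t k) = (\<Sum>k\<le>Suc n. gauss_binom q n k * q ^ (k choose 2) * (z * q) ^ k * a ^ (Suc n - k))"
      by (simp add: gauss_binom_eq_0, intro sum.cong) (auto simp: Suc_diff_le algebra_simps)
    also have "\<dots> = a ^ Suc n + (\<Sum>k\<le>n. gauss_binom q n (Suc k) * q ^ (Suc k choose 2) * (z * q) ^ Suc k * a ^ (n - k))"
      by (subst sum.atMost_Suc_shift) (simp add: numeral_2_eq_2)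
    finally show ?thesis
      by (simp add: power_mult_distrib mult_ac)
  qed
  also have "(\<Sum>k\<le>n. z * ?t k) = (\<Sum>k\<le>n. gauss_binom q n k
      * q ^ (Suc k choose 2) * z ^ Suc k * a ^ (n - k))"
    by (intro sum.cong) (auto simp: choose_two_Suc power_mult_distrib power_add mult_ac)
  also have "a ^ Suc n + (\<Sum>k\<le>n. q ^ Suc k * gauss_binom q n (Suc k)
      * q ^ (Suc k choose 2) * z ^ Suc k * a ^ (n - k)) + \<dots>
      = a ^ Suc n + (\<Sum>k\<le>n. gauss_binom q (Suc n) (Suc k) * q ^ (Suc k choose 2) * z ^ Suc k * a ^ (n - k))"
    by (simp add: sum.distrib[symmetric] distrib_right add_ac)
  also have "\<dots> = (\<Sum>k\<le>Suc n. gauss_binom q (Suc n) k * q ^ (k choose 2) * z ^ k * a ^ (Suc n - k))"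
    by (subst sum.atMost_Suc_shift) (simp add: numeral_2_eq_2)
  finally show ?case .
qed

lemma int_choose_two: "2 * int (n choose 2) = int n * (int n - 1)"
  by (induction n) (auto simp: choose_two_Suc algebra_simps numeral_2_eq_2)

lemma prod_power_choose_two: "(\<Prod>i<n. q ^ i) = (q :: 'a::comm_ring_1) ^ (n choose 2)"
  by (induction n) (auto simp: choose_two_Suc power_add mult_ac numeral_2_eq_2)

lemma int_half_consecutive: "2 * int (nat (j * (j + 1) div 2)) = j * (j + 1)"
proof -
  have "0 \<le> j * (j + 1)" by (cases "j \<ge> 0") (auto intro: mult_nonpos_nonpos)
  then show ?thesis by simp
qed

lemma int_half_consecutive': "2 * int (nat (j * (j - 1) div 2)) = j * (j - 1)"
  using int_half_consecutive[of "j - 1"] by (simp add: mult.commute)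

text \<open>
  With \<open>q = x y\<close>, the product of \<open>q\<^sup>n + x q\<^sup>i\<close> over \<open>i < 2n\<close> is the left-hand side up to a
  monomial: the upper half of the factors gives \<open>1 + x q\<^sup>i\<close>, and the lower half gives \<open>1 + y q\<^sup>i\<close> because
  \<open>q\<^sup>n + x q\<^sup>i = x q\<^sup>i (1 + y q\<^sup>n\<^sup>-\<^sup>1\<^sup>-\<^sup>i)\<close>. The \<open>q\<close>-binomial theorem expands the product, and the same
  monomial cancels.
\<close>

lemma finite_triple_product:
  fixes x y :: "'a::idom"
  assumes "x \<noteq> 0" "y \<noteq> 0"
  shows "(\<Prod>i<n. (1 + x * (x * y) ^ i) * (1 + y * (x * y) ^ i)) =
    (\<Sum>j\<in>{- int n..int n}. gauss_binom (x * y) (2 * n) (nat (int n + j)) *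
       (x ^ nat (j * (j + 1) div 2) * y ^ nat (j * (j - 1) div 2)))" (is "?L = ?R")
proof -
  define q where "q = x * y"
  \<comment> \<open>the monomial by which the product over \<open>i < 2n\<close> differs from the left-hand side\<close>
  define c where "c = x ^ n * q ^ (n choose 2) * q ^ (n * n)"
  have "c \<noteq> 0" using assms by (simp add: c_def q_def)
  have "(\<Prod>i<2 * n. q ^ n + x * q ^ i) = (\<Prod>i<n. q ^ n + x * q ^ i) * (\<Prod>i<n. q ^ n + x * q ^ (n + i))"
  proof -
    have "(\<Prod>i<n + n. q ^ n + x * q ^ i) = (\<Prod>i<n. q ^ n + x * q ^ i) * (\<Prod>i<n. q ^ n + x * q ^ (n + i))"
      by (simp only: prod.nat_group[symmetric] lessThan_atLeast0 prod.atLeastLessThan_concat[symmetric, of 0 n "n + n"] le0 le_add1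
           prod.shift_bounds_nat_ivl[of _ 0 n n, simplified] add.commute)
    then show ?thesis by (simp add: mult_2)
  qed
  also have "(\<Prod>i<n. q ^ n + x * q ^ i) = (\<Prod>i<n. x * q ^ i * (1 + y * q ^ (n - Suc i)))"
  proof (intro prod.cong refl)
    fix i assume "i \<in> {..<n}"
    then have "q ^ n = q ^ (Suc i + (n - Suc i))"
      by simp
    then have "q ^ n = q ^ i * q * q ^ (n - Suc i)"
      by (simp only: power_add power_Suc2)
    then show "q ^ n + x * q ^ i = x * q ^ i * (1 + y * q ^ (n - Suc i))"
      by (simp add: algebra_simps q_def)
  qed
  also have "\<dots> = x ^ n * q ^ (n choose 2) * (\<Prod>i<n. 1 + y * q ^ i)"
    by (simp add: prod.distrib prod_power_choose_two prod.nat_diff_reindex[of "\<lambda>i. 1 + y * q ^ i"])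
  also have "(\<Prod>i<n. q ^ n + x * q ^ (n + i)) = q ^ (n * n) * (\<Prod>i<n. 1 + x * q ^ i)"
  proof -
    have "(\<Prod>i<n. q ^ n + x * q ^ (n + i)) = (\<Prod>i<n. q ^ n * (1 + x * q ^ i))"
      by (intro prod.cong) (auto simp: algebra_simps power_add)
    then show ?thesis by (simp add: prod.distrib power_mult)
  qed
  finally have L: "(\<Prod>i<2 * n. q ^ n + x * q ^ i) = c * ?L"
    unfolding q_def[symmetric] prod.distrib by (simp add: c_def mult_ac)
  have "(\<Prod>i<2 * n. q ^ n + x * q ^ i) = (\<Sum>k\<le>2 * n. gauss_binom q (2 * n) k * q ^ (k choose 2) * x ^ k * (q ^ n) ^ (2 * n - k))"
    by (rule rothe)
  also have "\<dots> = (\<Sum>j\<in>{- int n..int n}. c * (gauss_binom q (2 * n) (nat (int n + j)) *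
       (x ^ nat (j * (j + 1) div 2) * y ^ nat (j * (j - 1) div 2))))"
  proof (rule sum.reindex_bij_witness[of _ "\<lambda>j. nat (int n + j)" "\<lambda>k. int k - int n"])
    fix k assume "k \<in> {..2 * n}"
    then have k: "k \<le> 2 * n" by simp
    define j where "j = int k - int n"
    define a b where "a = nat (j * (j + 1) div 2)" and "b = nat (j * (j - 1) div 2)"
    have ab: "2 * int a = j * (j + 1)" "2 * int b = j * (j - 1)"
      unfolding a_def b_def by (rule int_half_consecutive int_half_consecutive')+
    have e: "int (n * (2 * n - k)) = int n * (2 * int n - int k)"
      using k by (simp add: of_nat_diff)
    have "2 * int ((k choose 2) + k + n * (2 * n - k)) = 2 * int (n + (n choose 2) + n * n + a)"
      unfolding of_nat_add distrib_left int_choose_two e ab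
      by (simp add: j_def algebra_simps)
    then have ex: "(k choose 2) + k + n * (2 * n - k) = n + (n choose 2) + n * n + a"
      unfolding mult_cancel_left of_nat_eq_iff by simp
    have "2 * int ((k choose 2) + n * (2 * n - k)) = 2 * int ((n choose 2) + n * n + b)"
      unfolding of_nat_add distrib_left int_choose_two e ab
      by (simp add: j_def algebra_simps)
    then have ey: "(k choose 2) + n * (2 * n - k) = (n choose 2) + n * n + b"
      unfolding mult_cancel_left of_nat_eq_iff by simp
    have "q ^ (k choose 2) * x ^ k * (q ^ n) ^ (2 * n - k) = x ^ ((k choose 2) + k + n * (2 * n - k)) * y ^ ((k choose 2) + n * (2 * n - k))"
      by (simp add: q_def power_mult_distrib power_add power_mult mult_ac)
    also have "\<dots> = c * (x ^ a * y ^ b)"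
      unfolding ex ey by (simp add: c_def q_def power_mult_distrib power_add mult_ac)
    finally show "c * (gauss_binom q (2 * n) (nat (int n + (int k - int n))) *
       (x ^ nat ((int k - int n) * (int k - int n + 1) div 2) * y ^ nat ((int k - int n) * (int k - int n - 1) div 2)))
       = gauss_binom q (2 * n) k * q ^ (k choose 2) * x ^ k * (q ^ n) ^ (2 * n - k)"
      unfolding a_def b_def j_def by (simp add: mult_ac)
  qed auto
  also have "\<dots> = c * ?R"
    by (simp add: sum_distrib_left q_def)
  finally show ?thesis
    using L \<open>c \<noteq> 0\<close> by simp
qed

text \<open>
  The sign \<open>(-1)\<^sup>j\<close> for an integer \<open>j\<close> of either sign.
\<close>

definition alt :: "int \<Rightarrow> int" where
  "alt j = (if even j then 1 else -1)"

lemma gauss_binom_const_poly: "gauss_binom [:q:] n k = [:gauss_binom q n k:]"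
  by (induction q n k rule: gauss_binom.induct) (auto simp: poly_const_pow one_pCons)

text \<open>
  The polynomial \<open>F(z) = \<Prod>\<^sub>i\<^sub><\<^sub>2\<^sub>n\<^sub>+\<^sub>1 (q\<^sup>n - z q\<^sup>i)\<close> has a simple zero at \<open>z = 1\<close> from the middle factor
  \<open>i = n\<close>, so \<open>F'(1)\<close> is the product of the other factors, which is \<open>(q; q)\<^sub>n\<^sup>2\<close> up to a monomial. By the
  \<open>q\<close>-binomial theorem \<open>F'(1)\<close> is also \<open>\<Sum> k t\<^sub>k\<close>. As \<open>\<Sum> t\<^sub>k = F(1) = 0\<close>, the weight \<open>k\<close> may be
  replaced by the symmetric weight \<open>2k - (2n + 1) = 2j + 1\<close> at the cost of a factor 2.
\<close>

lemma finite_jacobi: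
  fixes q :: "'a::idom"
  assumes "q \<noteq> 0"
  shows "(\<Sum>j\<in>{- int n - 1..int n}. gauss_binom q (2 * n + 1) (nat (int n + 1 + j)) *
       (of_int (alt j * (2 * j + 1)) * q ^ nat (j * (j + 1) div 2))) = 2 * qfact q n ^ 2"
proof -
  define N where "N = 2 * n + 1"
  define t where "t k = gauss_binom q N k * q ^ (k choose 2) * (- 1) ^ k * (q ^ n) ^ (N - k)" for k
  define F where "F = (\<Prod>i<N. [:q ^ n, - (q ^ i):])"
  have F: "F = (\<Sum>k\<le>N. monom (t k) k)"
  proof -
    have "F = (\<Prod>i<N. [:q ^ n:] + [:0, -1:] * [:q:] ^ i)"
      unfolding F_def by (intro prod.cong) (auto simp: poly_const_pow)
    also have "\<dots> = (\<Sum>k\<le>N. monom (t k) k)"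
      unfolding rothe t_def
    proof (intro sum.cong refl)
      fix k
      have m: "[:0, -1:] ^ k = monom ((-1) ^ k :: 'a) k"
        using monom_power[of "-1 :: 'a" 1 k] by (simp add: monom_altdef)
      show "gauss_binom [:q:] N k * [:q:] ^ (k choose 2) * [:0, -1:] ^ k * [:q ^ n:] ^ (N - k) =
         monom (gauss_binom q N k * q ^ (k choose 2) * (- 1) ^ k * (q ^ n) ^ (N - k)) k"
        unfolding m by (simp add: gauss_binom_const_poly poly_const_pow smult_monom mult_ac)
    qed
    finally show ?thesis .
  qed
  have n: "n < N" by (simp add: N_def)
  have F0: "(\<Sum>k\<le>N. t k) = 0"
  proof -
    have "poly F 1 = 0" unfolding F_def poly_prod
      using n by (auto simp: prod_zero_iff)
    then show ?thesis unfolding F by (simp add: poly_sum poly_monom)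
  qed
  have "poly (pderiv F) 1 = (\<Prod>i\<in>{..<N} - {n}. q ^ n - q ^ i) * - (q ^ n)"
  proof -
    have "F = [:q ^ n, - (q ^ n):] * (\<Prod>i\<in>{..<N} - {n}. [:q ^ n, - (q ^ i):])"
      unfolding F_def by (rule prod.remove) (auto simp: n)
    then have "pderiv F = [:q ^ n, - (q ^ n):] * pderiv (\<Prod>i\<in>{..<N} - {n}. [:q ^ n, - (q ^ i):])
        + (\<Prod>i\<in>{..<N} - {n}. [:q ^ n, - (q ^ i):]) * [:- (q ^ n):]"
      by (simp only: pderiv_mult) (simp add: pderiv_pCons)
    then show ?thesis by (simp add: poly_prod)
  qed
  also have "{..<N} - {n} = {..<n} \<union> (\<lambda>i. n + 1 + i) ` {..<n}"
  proof (intro equalityI subsetI)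
    fix i assume "i \<in> {..<N} - {n}"
    then show "i \<in> {..<n} \<union> (\<lambda>i. n + 1 + i) ` {..<n}"
      by (cases "i < n") (auto simp: N_def image_iff intro!: bexI[of _ "i - n - 1"])
  qed (auto simp: N_def)
  also have "(\<Prod>i\<in>{..<n} \<union> (\<lambda>i. n + 1 + i) ` {..<n}. q ^ n - q ^ i)
      = (\<Prod>i<n. q ^ n - q ^ i) * (\<Prod>i<n. q ^ n - q ^ (n + 1 + i))"
    by (subst prod.union_disjoint) (auto simp: prod.reindex inj_on_def)
  also have "(\<Prod>i<n. q ^ n - q ^ i) = (\<Prod>i<n. (- 1) * q ^ i * (1 - q ^ Suc (n - Suc i)))"
  proof (intro prod.cong refl)
    fix i assume "i \<in> {..<n}"
    then have "q ^ n = q ^ i * q ^ Suc (n - Suc i)"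
      by (simp flip: power_add power_Suc)
    then show "q ^ n - q ^ i = (- 1) * q ^ i * (1 - q ^ Suc (n - Suc i))"
      by (simp add: algebra_simps)
  qed
  also have "\<dots> = (- 1) ^ n * q ^ (n choose 2) * qfact q n"
    unfolding prod.distrib prod_power_choose_two qfact_def
    by (subst prod.nat_diff_reindex[of "\<lambda>i. 1 - q ^ Suc i"]) simp
  also have "(\<Prod>i<n. q ^ n - q ^ (n + 1 + i)) = (\<Prod>i<n. q ^ n * (1 - q ^ Suc i))"
    by (intro prod.cong) (auto simp: algebra_simps power_add)
  also have "\<dots> = q ^ (n * n) * qfact q n"
    by (simp add: prod.distrib power_mult qfact_def)
  finally have D: "poly (pderiv F) 1 = - ((- 1) ^ n * q ^ ((n choose 2) + n * n + n) * qfact q n ^ 2)"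
    by (simp add: power_add power2_eq_square mult_ac)
  have D': "poly (pderiv F) 1 = (\<Sum>k\<le>N. of_nat k * t k)"
    unfolding F by (simp add: higher_pderiv_sum[of 1, simplified] pderiv_monom poly_sum poly_monom)
  define c where "c = - ((- 1) ^ n * q ^ ((n choose 2) + n * n + n))"
  have "c \<noteq> 0" using assms by (simp add: c_def)
  have "c * (2 * qfact q n ^ 2) = 2 * (\<Sum>k\<le>N. of_nat k * t k) - of_nat N * (\<Sum>k\<le>N. t k)"
    unfolding F0 D'[symmetric] D c_def by simp
  also have "\<dots> = (\<Sum>k\<le>N. of_int (2 * int k - int N) * t k)"
    by (simp add: sum_distrib_left sum_subtractf algebra_simps)
  also have "\<dots> = (\<Sum>j\<in>{- int n - 1..int n}. c * (gauss_binom q N (nat (int n + 1 + j)) *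
       (of_int (alt j * (2 * j + 1)) * q ^ nat (j * (j + 1) div 2))))"
  proof (rule sum.reindex_bij_witness[of _ "\<lambda>j. nat (int n + 1 + j)" "\<lambda>k. int k - int n - 1"])
    fix k assume "k \<in> {..N}"
    then have k: "k \<le> N" by simp
    define j where "j = int k - int n - 1"
    define a where "a = nat (j * (j + 1) div 2)"
    have a: "2 * int a = j * (j + 1)"
      unfolding a_def by (rule int_half_consecutive)
    have e: "int (n * (N - k)) = int n * (2 * int n + 1 - int k)"
      using k by (simp add: of_nat_diff N_def)
    have "2 * int ((k choose 2) + n * (N - k)) = 2 * int ((n choose 2) + n * n + n + a)"
      unfolding of_nat_add distrib_left int_choose_two e a
      by (simp add: j_def algebra_simps)
    then have ex: "(k choose 2) + n * (N - k) = (n choose 2) + n * n + n + a"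
      unfolding mult_cancel_left of_nat_eq_iff by simp
    have s: "(- 1) ^ k = - ((- 1) ^ n * of_int (alt j) :: 'a)"
      using k by (auto simp: alt_def j_def minus_one_power_iff)
    have "t k = gauss_binom q N k * q ^ ((k choose 2) + n * (N - k)) * (- 1) ^ k"
      by (simp add: t_def power_add power_mult mult_ac)
    also have "\<dots> = c * (gauss_binom q N k * of_int (alt j) * q ^ a)"
      unfolding ex s by (simp add: c_def power_add mult_ac)
    finally have "t k = c * (gauss_binom q N k * of_int (alt j) * q ^ a)" .
    moreover have "2 * int k - int N = 2 * j + 1" by (simp add: j_def N_def)
    moreover have "nat (int n + 1 + j) = k" by (simp add: j_def)
    ultimately have "c * (gauss_binom q N (nat (int n + 1 + j)) *
       (of_int (alt j * (2 * j + 1)) * q ^ a)) = of_int (2 * int k - int N) * t k"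
      by (simp only: of_int_mult mult_ac)
    then show "c * (gauss_binom q N (nat (int n + 1 + (int k - int n - 1))) *
       (of_int (alt (int k - int n - 1) * (2 * (int k - int n - 1) + 1)) * q ^ nat ((int k - int n - 1) * ((int k - int n - 1) + 1) div 2)))
       = of_int (2 * int k - int N) * t k"
      unfolding a_def j_def .
  qed (auto simp: N_def)
  finally show ?thesis
    using \<open>c \<noteq> 0\<close> unfolding sum_distrib_left[symmetric] N_def by simp
qed

section \<open>Limits and infinite products of formal power series\<close>

definition agree :: "nat \<Rightarrow> 'a fps \<Rightarrow> 'a fps \<Rightarrow> bool" where
  "agree N f g \<longleftrightarrow> (\<forall>i\<le>N. f $ i = g $ i)"

lemma agree_mult:
  fixes f g h k :: "'a::comm_ring_1 fps"
  shows "agree N f g \<Longrightarrow> agree N h k \<Longrightarrow> agree N (f * h) (g * k)"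
  by (auto simp: agree_def fps_mult_nth intro!: sum.cong)

lemma agree_refl [simp]: "agree N f f"
  by (simp add: agree_def)

lemma agree_sym: "agree N f g \<Longrightarrow> agree N g f"
  by (simp add: agree_def)

lemma agree_trans: "agree N f g \<Longrightarrow> agree N g h \<Longrightarrow> agree N f h"
  by (simp add: agree_def)

lemma agree_cancel:
  fixes f g h :: "'a::idom fps"
  assumes "agree N (h * f) (h * g)" "h $ 0 \<noteq> 0"
  shows "agree N f g"
proof (rule ccontr)
  assume "\<not> agree N f g"
  then obtain i where i: "i \<le> N" "(f - g) $ i \<noteq> 0"
    by (auto simp: agree_def)
  define m where "m = subdegree (f - g)"
  have "m \<le> i" using i(2) unfolding m_def by (rule subdegree_leI)
  have "f - g \<noteq> 0" using i(2) by auto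
  moreover from this have "h * (f - g) \<noteq> 0" using assms(2) by auto
  moreover have "subdegree (h * (f - g)) = m"
    using assms(2) \<open>f - g \<noteq> 0\<close> unfolding m_def by (subst subdegree_mult) auto
  ultimately have "(h * (f - g)) $ m \<noteq> 0"
    using nth_subdegree_nonzero by blast
  then show False
    using assms(1) i(1) \<open>m \<le> i\<close> by (auto simp: agree_def right_diff_distrib)
qed

lemma agree_tendsto:
  fixes F :: "nat \<Rightarrow> 'a::comm_ring_1 fps"
  shows "F \<longlonglongrightarrow> G \<longleftrightarrow> (\<forall>N. \<forall>\<^sub>F n in sequentially. agree N (F n) G)"
proof
  assume "F \<longlonglongrightarrow> G"
  then have "\<forall>i\<in>{..N}. \<forall>\<^sub>F n in sequentially. F n $ i = G $ i" for N
    by (simp add: tendsto_fps_iff)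
  then have "\<forall>\<^sub>F n in sequentially. \<forall>i\<in>{..N}. F n $ i = G $ i" for N
    by (intro eventually_ball_finite) auto
  then show "\<forall>N. \<forall>\<^sub>F n in sequentially. agree N (F n) G"
    by (simp add: agree_def Ball_def)
next
  assume *: "\<forall>N. \<forall>\<^sub>F n in sequentially. agree N (F n) G"
  show "F \<longlonglongrightarrow> G"
  proof (rule tendsto_fpsI)
    fix N
    show "\<forall>\<^sub>F n in sequentially. F n $ N = G $ N"
      using *[rule_format, of N] by eventually_elim (simp add: agree_def)
  qed
qed

lemma tendsto_fps_mult:
  fixes F G :: "nat \<Rightarrow> 'a::comm_ring_1 fps"
  assumes "F \<longlonglongrightarrow> A" "G \<longlonglongrightarrow> B"
  shows "(\<lambda>n. F n * G n) \<longlonglongrightarrow> A * B"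
  unfolding agree_tendsto
proof
  fix N
  show "\<forall>\<^sub>F n in sequentially. agree N (F n * G n) (A * B)"
    using assms[unfolded agree_tendsto, rule_format, of N]
    by eventually_elim (rule agree_mult)
qed

text \<open>
  The coefficient of index \<open>N\<close> is read off the first \<open>N\<close> factors. This is the infinite product
  whenever the factor \<open>f i\<close> is \<open>1 + O(q\<^sup>i\<^sup>+\<^sup>1)\<close>, the condition \<open>agree i (f i) 1\<close> below.
\<close>

definition infprod :: "(nat \<Rightarrow> 'a::comm_ring_1 fps) \<Rightarrow> 'a fps" where
  "infprod f = Abs_fps (\<lambda>N. (\<Prod>i<N. f i) $ N)"

lemma infprod_agree:
  assumes "\<And>i. agree i (f i) 1" "N \<le> n"
  shows "agree N (infprod f) (\<Prod>i<n. f i)"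
proof -
  have stable: "(\<Prod>i<M + d. f i) $ M = (\<Prod>i<M. f i) $ M" for M d
  proof (induction d)
    case (Suc d)
    have "agree M ((\<Prod>i<M + d. f i) * f (M + d)) ((\<Prod>i<M + d. f i) * 1)"
    proof (rule agree_mult)
      show "agree M (f (M + d)) 1" using assms(1)[of "M + d"] by (auto simp: agree_def)
    qed simp
    then show ?case using Suc by (simp add: agree_def mult.commute)
  qed simp
  show ?thesis unfolding agree_def
  proof (intro allI impI)
    fix i assume "i \<le> N"
    then show "infprod f $ i = (\<Prod>i<n. f i) $ i"
      using stable[of i "n - i"] assms(2) by (simp add: infprod_def)
  qed
qed

lemma infprod_tendsto:
  assumes "\<And>i. agree i (f i) 1"
  shows "(\<lambda>n. \<Prod>i<n. f i) \<longlonglongrightarrow> infprod f"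
  unfolding agree_tendsto
proof
  fix N
  show "\<forall>\<^sub>F n in sequentially. agree N (\<Prod>i<n. f i) (infprod f)"
    using eventually_ge_at_top[of N]
    by eventually_elim (rule agree_sym, rule infprod_agree[OF assms])
qed

lemma infprod_eqI:
  assumes "\<And>i. agree i (f i) 1" "(\<lambda>n. \<Prod>i<n. f i) \<longlonglongrightarrow> A"
  shows "infprod f = A"
  using LIMSEQ_unique[OF infprod_tendsto[OF assms(1)] assms(2)] .

lemma infprod_regroup:
  assumes "\<And>i. agree i (f i) 1" "k > 0" "(\<lambda>n. \<Prod>i<k * n. f i) \<longlonglongrightarrow> A"
  shows "infprod f = A"
proof -
  have "filterlim (\<lambda>n. k * n) sequentially sequentially"
    using assms(2) by (intro filterlim_subseq strict_monoI) simp
  then have "(\<lambda>n. \<Prod>i<k * n. f i) \<longlonglongrightarrow> infprod f"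
    by (rule filterlim_compose[OF infprod_tendsto[OF assms(1)]])
  then show ?thesis using assms(3) by (rule LIMSEQ_unique)
qed

lemma infprod_mult:
  fixes f g :: "nat \<Rightarrow> 'a::comm_ring_1 fps"
  assumes "\<And>i. agree i (f i) 1" "\<And>i. agree i (g i) 1"
  shows "infprod (\<lambda>i. f i * g i) = infprod f * infprod g"
proof (rule infprod_eqI)
  fix i show "agree i (f i * g i) 1"
    using agree_mult[OF assms(1)[of i] assms(2)[of i]] by simp
next
  show "(\<lambda>n. \<Prod>i<n. f i * g i) \<longlonglongrightarrow> infprod f * infprod g"
    unfolding prod.distrib by (intro tendsto_fps_mult infprod_tendsto assms)
qed

lemma agree_one_plus_X_power: "i < m \<Longrightarrow> agree i (1 + a * fps_X ^ m) 1"
  unfolding agree_def fps_add_nth fps_X_power_mult_right_nth by simp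

lemma agree_one_minus_X_power: "i < m \<Longrightarrow> agree i (1 - fps_X ^ m) (1 :: 'a::comm_ring_1 fps)"
  by (auto simp: agree_def)

definition euler :: "nat \<Rightarrow> int fps" where
  "euler c = infprod (\<lambda>i. 1 - fps_X ^ (c * Suc i))"

lemma euler_factor: "c > 0 \<Longrightarrow> agree i (1 - fps_X ^ (c * Suc i)) (1 :: 'a::comm_ring_1 fps)"
  by (rule agree_one_minus_X_power) (cases c; auto)

lemma qfact_fps_X_power: "qfact (fps_X ^ c) n = (\<Prod>i<n. 1 - fps_X ^ (c * Suc i))"
  by (simp only: qfact_def power_mult)

lemma euler_agree: "c > 0 \<Longrightarrow> N \<le> n \<Longrightarrow> agree N (euler c) (qfact (fps_X ^ c) n)"
  unfolding euler_def qfact_fps_X_power by (rule infprod_agree[OF euler_factor])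

lemma euler_tendsto: "c > 0 \<Longrightarrow> (\<lambda>n. qfact (fps_X ^ c) n) \<longlonglongrightarrow> euler c"
  unfolding euler_def qfact_fps_X_power by (rule infprod_tendsto[OF euler_factor])

lemma euler_nth_0 [simp]: "euler c $ 0 = 1"
  by (simp add: euler_def infprod_def)

lemma euler_nonzero [simp]: "euler c \<noteq> 0"
  using euler_nth_0[of c] by (metis fps_zero_nth zero_neq_one)

text \<open>
  The Gaussian binomial with both lower indices large tends to \<open>1 / E\<^sub>c\<close>: in its product form each of
  the three factorials tends to \<open>E\<^sub>c\<close>.
\<close>

lemma gauss_binom_limit:
  assumes "c > 0" "N \<le> m" "N \<le> k"
  shows "agree N (euler c * gauss_binom (fps_X ^ c) (m + k) k) 1"
proof (rule agree_cancel)
  let ?B = "gauss_binom (fps_X ^ c) (m + k) k :: int fps"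
  have "agree N (?B * (euler c * euler c)) (?B * (qfact (fps_X ^ c) m * qfact (fps_X ^ c) k))"
    using assms by (intro agree_mult euler_agree) auto
  also have "?B * (qfact (fps_X ^ c) m * qfact (fps_X ^ c) k) = qfact (fps_X ^ c) (m + k)"
    by (rule gauss_binom_mult_qfact)
  finally have "agree N (?B * (euler c * euler c)) (euler c)"
    using agree_sym[OF euler_agree[of c N "m + k"]] assms agree_trans by fastforce
  then show "agree N (euler c * (euler c * ?B)) (euler c * 1)"
    by (simp add: mult_ac)
qed simp

section \<open>Theta series\<close>

definition theta :: "('i \<Rightarrow> int) \<Rightarrow> ('i \<Rightarrow> nat) \<Rightarrow> int fps" where
  "theta w e = Abs_fps (\<lambda>N. \<Sum>i | e i = N. w i)"

lemma int_fps_const: "(of_int c :: int fps) = fps_const c"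
  by (rule fps_of_int[of c, where 'a = int, unfolded of_int_eq_id id_apply, symmetric])

text \<open>
  The finite identities are sums over \<open>i \<in> S n\<close> with extra factors \<open>g n i\<close>. Up to any fixed order only
  finitely many exponents matter, and for these the index is eventually in \<open>S n\<close> and the factor is eventually 1.
\<close>

lemma theta_tendsto:
  fixes g :: "nat \<Rightarrow> 'i \<Rightarrow> int fps"
  assumes fin: "\<And>n. finite (S n)"
    and ev: "\<And>N. \<forall>\<^sub>F n in sequentially. \<forall>i. e i \<le> N \<longrightarrow> i \<in> S n \<and> agree N (g n i) 1"
  shows "(\<lambda>n. \<Sum>i\<in>S n. g n i * (of_int (w i) * fps_X ^ e i)) \<longlonglongrightarrow> theta w e"
proof (rule tendsto_fpsI)
  fix N
  show "\<forall>\<^sub>F n in sequentially. (\<Sum>i\<in>S n. g n i * (of_int (w i) * fps_X ^ e i)) $ N = theta w e $ N"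
    using ev[of N]
  proof eventually_elim
    case (elim n)
    have c: "(g n i * (of_int (w i) * fps_X ^ e i)) $ N = (if e i = N then w i else 0)" for i
    proof -
      have "(g n i * (of_int (w i) * fps_X ^ e i)) $ N = (fps_const (w i) * (g n i * fps_X ^ e i)) $ N"
        unfolding int_fps_const by (simp only: mult_ac)
      also have "\<dots> = (if N < e i then 0 else w i * g n i $ (N - e i))"
        unfolding fps_mult_left_const_nth fps_X_power_mult_right_nth by simp
      also have "\<dots> = (if e i = N then w i else 0)"
        using elim by (auto simp: agree_def)
      finally show ?thesis .
    qed
    have "(\<Sum>i\<in>S n. g n i * (of_int (w i) * fps_X ^ e i)) $ N = (\<Sum>i\<in>S n. if e i = N then w i else 0)"
      by (simp add: fps_sum_nth c)
    also have "\<dots> = (\<Sum>i\<in>S n \<inter> {i. e i = N}. w i)"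
      by (simp add: sum.inter_restrict[OF fin])
    also have "S n \<inter> {i. e i = N} = {i. e i = N}"
      using elim by auto
    finally show ?case by (simp add: theta_def)
  qed
qed

lemma nat_half_consecutive_add: "nat (j * (j + 1) div 2) + nat (j * (j - 1) div 2) = nat (j * j)"
proof -
  have "2 * int (nat (j * (j + 1) div 2) + nat (j * (j - 1) div 2)) = j * (j + 1) + j * (j - 1)"
    by (simp only: of_nat_add distrib_left[of 2] int_half_consecutive int_half_consecutive')
  also have "\<dots> = 2 * (j * j)"
    by (simp add: algebra_simps)
  also have "\<dots> = 2 * int (nat (j * j))"
    by simp
  finally have "2 * int (nat (j * (j + 1) div 2) + nat (j * (j - 1) div 2)) = 2 * int (nat (j * j))" .
  then show ?thesis unfolding mult_cancel_left of_nat_eq_iff by simp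
qed

lemma abs_le_square: "\<bar>j\<bar> \<le> j * (j :: int)"
proof (cases "j = 0")
  case False
  then have "\<bar>j\<bar> * 1 \<le> \<bar>j\<bar> * \<bar>j\<bar>" by (intro mult_left_mono) auto
  then show ?thesis by simp
qed simp

text \<open>
  The finite form with \<open>x = s q\<^sup>a\<close>, \<open>y = s q\<^sup>b\<close>. The two equal signs make \<open>x y = q\<^sup>a\<^sup>+\<^sup>b\<close> a pure power, and
  \<open>s\<close> occurs to the power \<open>j\<^sup>2\<close>, which has the parity of \<open>j\<close>.
\<close>

lemma jacobi_triple_product:
  fixes s :: int
  assumes "a > 0" "b > 0" and s: "s = 1 \<or> s = - 1"
  shows "euler (a + b) *
      infprod (\<lambda>i. (1 + of_int s * fps_X ^ (a + (a + b) * i)) * (1 + of_int s * fps_X ^ (b + (a + b) * i)))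
    = theta (\<lambda>j. if even j then 1 else s) (\<lambda>j. a * nat (j * (j + 1) div 2) + b * nat (j * (j - 1) div 2))"
    (is "_ * infprod ?f = theta ?w ?e")
proof -
  define c where "c = a + b"
  have c: "c > 0" using assms by (simp add: c_def)
  define x y :: "int fps" where "x = of_int s * fps_X ^ a" and "y = of_int s * fps_X ^ b"
  have xy: "x * y = fps_X ^ c"
    using s by (auto simp: x_def y_def c_def power_add)
  have nz: "x \<noteq> 0" "y \<noteq> 0" using s by (auto simp: x_def y_def)
  have "?f i = (1 + x * (x * y) ^ i) * (1 + y * (x * y) ^ i)" for i
  proof -
    have "fps_X ^ (u + (a + b) * i) = (fps_X ^ u * (fps_X ^ (a + b)) ^ i :: int fps)" for u
      by (simp only: power_add[of _ u] power_mult)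
    then show ?thesis
      unfolding xy by (simp only: x_def y_def c_def mult.assoc)
  qed
  then have finite_form: "euler c * (\<Prod>i<n. ?f i) = (\<Sum>j\<in>{- int n..int n}.
      (euler c * gauss_binom (fps_X ^ c) (2 * n) (nat (int n + j))) * (of_int (?w j) * fps_X ^ ?e j))" for n
  proof -
    assume f: "\<And>i. ?f i = (1 + x * (x * y) ^ i) * (1 + y * (x * y) ^ i)"
    have "x ^ nat (j * (j + 1) div 2) * y ^ nat (j * (j - 1) div 2) = of_int (?w j) * fps_X ^ ?e j" for j
    proof -
      have "x ^ nat (j * (j + 1) div 2) * y ^ nat (j * (j - 1) div 2)
          = of_int s ^ (nat (j * (j + 1) div 2) + nat (j * (j - 1) div 2)) * fps_X ^ ?e j"
        by (simp add: x_def y_def power_mult_distrib power_add power_mult mult_ac)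
      also have "of_int s ^ (nat (j * (j + 1) div 2) + nat (j * (j - 1) div 2)) = (of_int (?w j) :: int fps)"
        unfolding nat_half_consecutive_add using s by (auto simp: minus_one_power_iff even_nat_iff)
      finally show ?thesis .
    qed
    then show ?thesis
      unfolding f xy finite_triple_product[OF nz, of n, unfolded xy] by (simp add: sum_distrib_left mult.assoc)
  qed
  have "agree i (?f i) (1 * 1)" for i
    using assms by (intro agree_mult agree_one_plus_X_power) (auto simp: add_mult_distrib intro: le_less_trans[of _ "a * i"])
  then have lim1: "(\<lambda>n. euler c * (\<Prod>i<n. ?f i)) \<longlonglongrightarrow> euler c * infprod ?f"
    by (intro tendsto_fps_mult infprod_tendsto tendsto_const) simp
  have "(\<lambda>n. euler c * (\<Prod>i<n. ?f i)) \<longlonglongrightarrow> theta ?w ?e"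
    unfolding finite_form
  proof (rule theta_tendsto)
    fix N
    show "\<forall>\<^sub>F n in sequentially. \<forall>j. ?e j \<le> N \<longrightarrow> j \<in> {- int n..int n} \<and>
        agree N (euler c * gauss_binom (fps_X ^ c) (2 * n) (nat (int n + j))) 1"
      \<comment> \<open>an exponent at most \<open>N\<close> forces \<open>\<bar>j\<bar> \<le> N\<close>, as the exponent is at least \<open>j\<^sup>2\<close>; then both
        \<open>n - j\<close> and \<open>n + j\<close> are at least \<open>N\<close>\<close>
      using eventually_ge_at_top[of "2 * N"]
    proof eventually_elim
      case (elim n)
      show ?case
      proof (intro allI impI)
        fix j assume j: "?e j \<le> N"
        have "nat (j * j) \<le> ?e j"
          unfolding nat_half_consecutive_add[symmetric] using assms(1,2) by (intro add_mono) auto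
        then have "\<bar>j\<bar> \<le> int N"
          using j abs_le_square[of j] by linarith
        moreover from this have "agree N (euler c * gauss_binom (fps_X ^ c) (nat (int n - j) + nat (int n + j)) (nat (int n + j))) 1"
          using elim c by (intro gauss_binom_limit) auto
        moreover have "nat (int n - j) + nat (int n + j) = 2 * n"
          using \<open>\<bar>j\<bar> \<le> int N\<close> elim by linarith
        ultimately show "j \<in> {- int n..int n} \<and>
            agree N (euler c * gauss_binom (fps_X ^ c) (2 * n) (nat (int n + j))) 1"
          using elim by auto
      qed
    qed
  qed simp
  with lim1 show ?thesis unfolding c_def by (rule LIMSEQ_unique)
qed

lemma abs_le_consecutive: "2 * (\<bar>j\<bar> - 1) \<le> j * (j + 1 :: int)"
proof -
  have "0 \<le> (\<bar>j\<bar> - 1) * (\<bar>j\<bar> - 2)"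
    by (cases "\<bar>j\<bar> \<le> 1") (auto intro: mult_nonpos_nonpos)
  then have "3 * \<bar>j\<bar> - 2 \<le> j * j"
    by (simp add: algebra_simps)
  then show ?thesis
    by (simp add: algebra_simps) 
qed

text \<open>
  Jacobi's identity, with the sum folded out to all integers: \<open>j\<close> and \<open>-1 - j\<close> contribute equally, whence
  the factor 2.
\<close>

lemma jacobi_cube:
  assumes c: "c > 0"
  shows "theta (\<lambda>j. alt j * (2 * j + 1)) (\<lambda>j. c * nat (j * (j + 1) div 2)) = 2 * euler c ^ 3"
    (is "theta ?w ?e = _")
proof (rule LIMSEQ_unique)
  have finite_form: "euler c * (2 * qfact (fps_X ^ c) n ^ 2) = (\<Sum>j\<in>{- int n - 1..int n}.
      (euler c * gauss_binom (fps_X ^ c) (2 * n + 1) (nat (int n + 1 + j))) * (of_int (?w j) * fps_X ^ ?e j))" for n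
    by (subst finite_jacobi[symmetric]) (auto simp: sum_distrib_left mult_ac power_mult)
  show "(\<lambda>n. euler c * (2 * qfact (fps_X ^ c) n ^ 2)) \<longlonglongrightarrow> 2 * euler c ^ 3"
  proof -
    have "(\<lambda>n. euler c * (2 * (qfact (fps_X ^ c) n * qfact (fps_X ^ c) n))) \<longlonglongrightarrow> euler c * (2 * (euler c * euler c))"
      by (intro tendsto_fps_mult tendsto_const euler_tendsto c)
    then show ?thesis by (simp add: power2_eq_square power3_eq_cube mult_ac)
  qed
  show "(\<lambda>n. euler c * (2 * qfact (fps_X ^ c) n ^ 2)) \<longlonglongrightarrow> theta ?w ?e"
    unfolding finite_form
  proof (rule theta_tendsto)
    fix N
    show "\<forall>\<^sub>F n in sequentially. \<forall>j. ?e j \<le> N \<longrightarrow> j \<in> {- int n - 1..int n} \<and>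
        agree N (euler c * gauss_binom (fps_X ^ c) (2 * n + 1) (nat (int n + 1 + j))) 1"
      using eventually_ge_at_top[of "2 * N + 1"]
    proof eventually_elim
      case (elim n)
      show ?case
      proof (intro allI impI)
        fix j assume j: "?e j \<le> N"
        have "nat (j * (j + 1) div 2) \<le> ?e j" using c by simp
        then have "2 * int (nat (j * (j + 1) div 2)) \<le> 2 * int N" using j by linarith
        then have "j * (j + 1) \<le> 2 * int N" unfolding int_half_consecutive .
        then have "2 * (\<bar>j\<bar> - 1) \<le> 2 * int N" by (rule order_trans[OF abs_le_consecutive])
        then have jN: "\<bar>j\<bar> \<le> int N + 1" by simp
        then have "agree N (euler c * gauss_binom (fps_X ^ c) (nat (int n - j) + nat (int n + 1 + j)) (nat (int n + 1 + j))) 1"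
          using elim c by (intro gauss_binom_limit) auto
        moreover have "nat (int n - j) + nat (int n + 1 + j) = 2 * n + 1"
          using jN elim by linarith
        ultimately show "j \<in> {- int n - 1..int n} \<and>
            agree N (euler c * gauss_binom (fps_X ^ c) (2 * n + 1) (nat (int n + 1 + j))) 1"
          using elim jN by auto
      qed
    qed
  qed simp
qed

definition odd_minus :: "int fps" where
  "odd_minus = infprod (\<lambda>i. 1 - fps_X ^ (2 * i + 1))"

definition odd_plus :: "int fps" where
  "odd_plus = infprod (\<lambda>i. 1 + fps_X ^ (2 * i + 1))"

lemma agree_odd_factors:
  "agree i (1 - fps_X ^ (2 * i + 1)) (1 :: int fps)" "agree i (1 + fps_X ^ (2 * i + 1)) (1 :: int fps)"
  using agree_one_minus_X_power[of i "2 * i + 1"] agree_one_plus_X_power[of i "2 * i + 1" 1] by auto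

lemma prod_split_parity:
  fixes h :: "nat \<Rightarrow> 'a::comm_monoid_mult"
  shows "(\<Prod>i<2 * n. h (Suc i)) = (\<Prod>i<n. h (2 * i + 1)) * (\<Prod>i<n. h (2 * Suc i))"
  by (induction n) (auto simp: mult_ac)

text \<open>
  The factors of \<open>E\<^sub>1\<close> sorted by the parity of the exponent.
\<close>

lemma odd_minus_mult_euler: "odd_minus * euler 2 = euler 1"
proof (rule sym)
  show "euler 1 = odd_minus * euler 2"
    unfolding euler_def[of 1]
  proof (rule infprod_regroup)
    show "0 < (2::nat)" by simp
    show "(\<lambda>n. \<Prod>i<2 * n. 1 - fps_X ^ (1 * Suc i)) \<longlonglongrightarrow> odd_minus * euler 2"
      unfolding prod_split_parity[where h = "\<lambda>i. 1 - fps_X ^ (1 * i)"]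
      unfolding odd_minus_def euler_def mult_1
      by (intro tendsto_fps_mult infprod_tendsto agree_odd_factors euler_factor) simp
  qed (simp only: euler_factor zero_less_one)
qed

text \<open>
  The factors of \<open>E\<^sub>2\<close> with exponent \<open>2 (2i + 1)\<close> split as \<open>(1 + q\<^sup>2\<^sup>i\<^sup>+\<^sup>1) (1 - q\<^sup>2\<^sup>i\<^sup>+\<^sup>1)\<close>; the other
  exponents are the multiples of 4.
\<close>

lemma odd_plus_mult_odd_minus_mult_euler: "odd_plus * odd_minus * euler 4 = euler 2"
proof (rule sym)
  show "euler 2 = odd_plus * odd_minus * euler 4"
    unfolding euler_def[of 2]
  proof (rule infprod_regroup)
    show "0 < (2::nat)" by simp
    have "(1 - fps_X ^ (2 * (2 * i + 1))) = (1 + fps_X ^ (2 * i + 1)) * (1 - fps_X ^ (2 * i + 1) :: int fps)" for i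
      by (simp add: algebra_simps power_add[symmetric] mult_2[symmetric] del: power_Suc)
    moreover have "2 * (2 * Suc i) = 4 * Suc i" for i
      by simp
    ultimately have eq: "(\<Prod>i<2 * n. 1 - fps_X ^ (2 * Suc i)) = ((\<Prod>i<n. 1 + fps_X ^ (2 * i + 1)) * (\<Prod>i<n. 1 - fps_X ^ (2 * i + 1)))
        * (\<Prod>i<n. 1 - fps_X ^ (4 * Suc i) :: int fps)" for n
      unfolding prod_split_parity[where h = "\<lambda>i. 1 - fps_X ^ (2 * i)"]
      by (simp only: prod.distrib)
    show "(\<lambda>n. \<Prod>i<2 * n. 1 - fps_X ^ (2 * Suc i)) \<longlonglongrightarrow> odd_plus * odd_minus * euler 4"
      unfolding eq odd_minus_def odd_plus_def euler_def
      by (intro tendsto_fps_mult infprod_tendsto agree_odd_factors euler_factor) simp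
  qed (simp only: euler_factor zero_less_numeral)
qed

text \<open>
  The triple product for \<open>x = y = q\<close>.
\<close>

lemma gauss_theta: "theta (\<lambda>_. 1) (\<lambda>n. nat (n * n)) = euler 2 * odd_plus ^ 2"
proof -
  have "euler (1 + 1) *
      infprod (\<lambda>i. (1 + of_int 1 * fps_X ^ (1 + (1 + 1) * i)) * (1 + of_int 1 * fps_X ^ (1 + (1 + 1) * i)))
    = theta (\<lambda>j. if even j then 1 else 1) (\<lambda>j. 1 * nat (j * (j + 1) div 2) + 1 * nat (j * (j - 1) div 2))"
    by (rule jacobi_triple_product) auto
  moreover have "infprod (\<lambda>i. (1 + of_int 1 * fps_X ^ (1 + (1 + 1) * i)) * (1 + of_int 1 * fps_X ^ (1 + (1 + 1) * i))) = odd_plus ^ 2"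
  proof -
    have "infprod (\<lambda>i. (1 + fps_X ^ (2 * i + 1)) * (1 + fps_X ^ (2 * i + 1))) = odd_plus * odd_plus"
      unfolding odd_plus_def by (intro infprod_mult agree_odd_factors)
    then show ?thesis by (simp add: power2_eq_square mult_2)
  qed
  ultimately show ?thesis by (simp add: nat_half_consecutive_add numeral_2_eq_2)
qed

lemma prod_split_mod3:
  fixes h :: "nat \<Rightarrow> 'a::comm_monoid_mult"
  shows "(\<Prod>i<3 * n. h (Suc i)) = (\<Prod>i<n. h (3 * Suc i)) * (\<Prod>i<n. h (2 + 3 * i) * h (1 + 3 * i))"
proof (induction n)
  case (Suc n)
  have e: "3 * Suc n = Suc (Suc (Suc (3 * n)))" "2 + 3 * n = Suc (Suc (3 * n))" "1 + 3 * n = Suc (3 * n)"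
    by simp_all
  have "(\<Prod>i<3 * Suc n. h (Suc i)) = (\<Prod>i<3 * n. h (Suc i)) * (h (1 + 3 * n) * h (2 + 3 * n) * h (3 * Suc n))"
    unfolding e prod.lessThan_Suc by (simp only: mult_ac)
  then show ?case unfolding Suc by (simp add: mult_ac)
qed simp

text \<open>
  The triple product for \<open>x = - q\<^sup>2\<^sup>c\<close>, \<open>y = - q\<^sup>c\<close>: the factors of \<open>E\<^sub>c\<close> are sorted by their index
  modulo 3.
\<close>

lemma pentagonal_number_theorem:
  assumes c: "c > 0"
  shows "theta alt (\<lambda>j. c * nat (j * (3 * j + 1) div 2)) = euler c"
proof -
  let ?f = "\<lambda>i. (1 + of_int (- 1) * fps_X ^ (2 * c + (2 * c + c) * i)) * (1 + of_int (- 1) * fps_X ^ (c + (2 * c + c) * i)) :: int fps"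
  have "euler (2 * c + c) * infprod ?f
    = theta (\<lambda>j. if even j then 1 else - 1) (\<lambda>j. 2 * c * nat (j * (j + 1) div 2) + c * nat (j * (j - 1) div 2))"
    using c by (intro jacobi_triple_product) auto
  moreover have "(\<lambda>j. 2 * c * nat (j * (j + 1) div 2) + c * nat (j * (j - 1) div 2)) = (\<lambda>j. c * nat (j * (3 * j + 1) div 2))"
  proof
    fix j :: int
    have "2 * int (2 * nat (j * (j + 1) div 2) + nat (j * (j - 1) div 2)) = j * (3 * j + 1)"
      using int_half_consecutive[of j] int_half_consecutive'[of j] by (simp add: algebra_simps)
    then have "nat (j * (3 * j + 1) div 2) = 2 * nat (j * (j + 1) div 2) + nat (j * (j - 1) div 2)"
      by (metis nat_int nonzero_mult_div_cancel_left zero_neq_numeral)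
    then show "2 * c * nat (j * (j + 1) div 2) + c * nat (j * (j - 1) div 2) = c * nat (j * (3 * j + 1) div 2)"
      by (simp add: algebra_simps)
  qed
  moreover have "(\<lambda>j. if even j then 1 else - 1) = alt"
    by (simp add: alt_def fun_eq_iff)
  moreover have "euler c = euler (2 * c + c) * infprod ?f"
    unfolding euler_def[of c]
  proof (rule infprod_regroup)
    show "0 < (3::nat)" by simp
    show "agree i (1 - fps_X ^ (c * Suc i)) (1 :: int fps)" for i
      by (rule euler_factor[OF c])
    have "agree i (?f i) (1 * 1)" for i
      using c by (intro agree_mult agree_one_plus_X_power) (auto simp: add_mult_distrib intro: le_less_trans[of _ "c * i"])
    then have f: "agree i (?f i) 1" for i by simp
    have "(\<Prod>i<3 * n. 1 - fps_X ^ (c * Suc i)) = (\<Prod>i<n. 1 - fps_X ^ ((2 * c + c) * Suc i)) * (\<Prod>i<n. ?f i)" for n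
      unfolding prod_split_mod3[where h = "\<lambda>i. 1 - fps_X ^ (c * i)"]
      by (simp add: algebra_simps)
    then show "(\<lambda>n. \<Prod>i<3 * n. 1 - fps_X ^ (c * Suc i)) \<longlonglongrightarrow> euler (2 * c + c) * infprod ?f"
      unfolding euler_def using c f
      by (simp only:) (intro tendsto_fps_mult infprod_tendsto euler_factor, auto)
  qed
  ultimately show ?thesis by simp
qed

section \<open>Products and derivatives of theta series\<close>

lemma theta_mult_nth:
  assumes e: "\<And>N. finite {i. e i = N}" and d: "\<And>N. finite {j. d j = N}"
  shows "(theta w e * theta v d) $ N = (\<Sum>(i, j) | e i + d j = N. w i * v j)"
    and "finite {(i, j). e i + d j = N}"
proof -
  have U: "{(i, j). e i + d j = N} = (\<Union>k\<in>{0..N}. {i. e i = k} \<times> {j. d j = N - k})"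
    by auto
  show "finite {(i, j). e i + d j = N}"
    unfolding U using e d by blast
  have "(theta w e * theta v d) $ N = (\<Sum>k=0..N. (\<Sum>i | e i = k. w i) * (\<Sum>j | d j = N - k. v j))"
    by (simp add: fps_mult_nth theta_def)
  also have "\<dots> = (\<Sum>k=0..N. \<Sum>(i, j)\<in>{i. e i = k} \<times> {j. d j = N - k}. w i * v j)"
    by (simp add: sum_product sum.cartesian_product)
  also have "\<dots> = (\<Sum>(i, j)\<in>(\<Union>k\<in>{0..N}. {i. e i = k} \<times> {j. d j = N - k}). w i * v j)"
    by (rule sum.UNION_disjoint[symmetric]) (use e d in auto)
  finally show "(theta w e * theta v d) $ N = (\<Sum>(i, j) | e i + d j = N. w i * v j)"
    unfolding U .
qed

text \<open>
  The operator \<open>q d/dq\<close>, which multiplies the coefficient of index \<open>n\<close> by \<open>n\<close> and so acts on theta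
  series by weighting each term with its exponent.
\<close>

definition qderiv :: "'a::comm_ring_1 fps \<Rightarrow> 'a fps" where
  "qderiv f = fps_X * fps_deriv f"

lemma qderiv_nth [simp]: "qderiv f $ n = of_nat n * f $ n"
  by (cases n) (auto simp: qderiv_def)

lemma qderiv_mult: "qderiv (f * g) = qderiv f * g + f * qderiv g"
  by (simp add: qderiv_def algebra_simps)

lemma qderiv_power: "qderiv (f ^ n) = of_nat n * f ^ (n - 1) * qderiv f"
  by (simp add: qderiv_def fps_deriv_power' algebra_simps)

lemma qderiv_theta: "qderiv (theta w e) = theta (\<lambda>i. int (e i) * w i) e"
  by (rule fps_ext) (simp add: theta_def sum_distrib_left)

lemma qderiv_theta_bracket_nth:
  fixes c :: int
  assumes e: "\<And>N. finite {i. e i = N}" and d: "\<And>N. finite {j. d j = N}"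
  shows "(of_int c * (qderiv (theta w e) * theta v d) - theta w e * qderiv (theta v d)) $ N
    = (\<Sum>(i, j) | e i + d j = N. (c * int (e i) - int (d j)) * (w i * v j))"
proof -
  have "(of_int c * (qderiv (theta w e) * theta v d) - theta w e * qderiv (theta v d)) $ N
    = c * (qderiv (theta w e) * theta v d) $ N - (theta w e * qderiv (theta v d)) $ N"
    unfolding int_fps_const by simp
  also have "\<dots> = (\<Sum>(i, j) | e i + d j = N. (c * int (e i) - int (d j)) * (w i * v j))"
    unfolding qderiv_theta theta_mult_nth(1)[OF e d]
    by (simp add: sum_distrib_left sum_subtractf[symmetric] case_prod_unfold algebra_simps)
  finally show ?thesis .
qed

text \<open>
  The slack of 1 admits exponents such as \<open>j (j + 1) / 2\<close>, which vanishes at \<open>j = -1\<close>.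
\<close>

lemma finite_int_fibre:
  fixes e :: "int \<Rightarrow> nat"
  assumes "\<And>j. \<bar>j\<bar> \<le> int (e j) + 1"
  shows "finite {j. e j = N}"
proof (rule finite_subset)
  show "{j. e j = N} \<subseteq> {- int N - 1..int N + 1}"
  proof
    fix j assume "j \<in> {j. e j = N}"
    then show "j \<in> {- int N - 1..int N + 1}"
      using assms[of j] by auto
  qed
qed simp

lemma int_pentagonal: "2 * int (nat (j * (3 * j + 1) div 2)) = j * (3 * j + 1)"
proof -
  have "0 \<le> j * (3 * j + 1)"
    by (cases "j \<ge> 0") (auto intro: mult_nonpos_nonpos)
  moreover have "even (j * (3 * j + 1))" by simp
  ultimately show ?thesis by simp
qed

lemma abs_le_3_square: "\<bar>j\<bar> \<le> j * (3 * j + 2 :: int)"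
  using abs_le_square[of j] by (simp add: algebra_simps)

lemma int_octagonal: "int (nat (j * (3 * j + 2))) = j * (3 * j + 2)"
  using abs_le_3_square[of j] by simp

lemma finite_fibres:
  assumes "c > 0"
  shows "finite {j::int. nat (j * j) = N}"
    and "finite {j::int. c * nat (j * (j + 1) div 2) = N}"
    and "finite {j::int. c * nat (j * (3 * j + 1) div 2) = N}"
    and "finite {j::int. nat (j * (3 * j + 2)) = N}"
proof -
  have c: "int n \<le> int (c * n)" for n
    unfolding of_nat_le_iff using assms by simp
  have bound: "2 * (x - 1) \<le> 2 * int t \<Longrightarrow> int t \<le> int u \<Longrightarrow> x \<le> int u + 1" for x :: int and t u :: nat
    by presburger
  show "finite {j::int. nat (j * j) = N}"
  proof (rule finite_int_fibre)
    fix j :: int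
    show "\<bar>j\<bar> \<le> int (nat (j * j)) + 1"
      using abs_le_square[of j] by simp
  qed
  show "finite {j::int. c * nat (j * (j + 1) div 2) = N}"
  proof (rule finite_int_fibre)
    fix j :: int
    have "2 * (\<bar>j\<bar> - 1) \<le> 2 * int (nat (j * (j + 1) div 2))"
      unfolding int_half_consecutive by (rule abs_le_consecutive)
    then show "\<bar>j\<bar> \<le> int (c * nat (j * (j + 1) div 2)) + 1"
      using c by (rule bound)
  qed
  show "finite {j::int. c * nat (j * (3 * j + 1) div 2) = N}"
  proof (rule finite_int_fibre)
    fix j :: int
    have "2 * \<bar>j\<bar> \<le> j * (3 * j + 1)"
      using abs_le_square[of j] by (simp add: algebra_simps)
    then have "2 * \<bar>j\<bar> \<le> 2 * int (nat (j * (3 * j + 1) div 2))"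
      unfolding int_pentagonal .
    then show "\<bar>j\<bar> \<le> int (c * nat (j * (3 * j + 1) div 2)) + 1"
      by (intro bound[OF _ c]) simp
  qed
  show "finite {j::int. nat (j * (3 * j + 2)) = N}"
  proof (rule finite_int_fibre)
    fix j :: int
    show "\<bar>j\<bar> \<le> int (nat (j * (3 * j + 2))) + 1"
      unfolding int_octagonal using abs_le_3_square[of j] by linarith
  qed
qed

section \<open>The octagonal theta series\<close>

lemma alt_add: "alt (i + j) = alt i * alt j"
  by (auto simp: alt_def)

lemma alt_3: "alt (3 * t) = alt t"
  by (auto simp: alt_def)

lemma sum_eq_0_by_involution:
  fixes f :: "'a \<Rightarrow> int"
  assumes "\<And>x. x \<in> A \<Longrightarrow> h x \<in> A" "\<And>x. x \<in> A \<Longrightarrow> h (h x) = x" "\<And>x. x \<in> A \<Longrightarrow> f (h x) = - f x"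
  shows "sum f A = 0"
proof -
  have "sum f A = (\<Sum>x\<in>A. - f x)"
    by (rule sum.reindex_bij_witness[of _ h h]) (use assms in auto)
  then show ?thesis by (simp add: sum_negf)
qed

text \<open>
  Put \<open>u = 2m + 1\<close>, \<open>w = u + n\<close> and \<open>v = u - 2n\<close>. Then \<open>v + w \<surd>-2 = (u + n \<surd>-2) (1 + \<surd>-2)\<close>, and
  taking norms, \<open>v\<^sup>2 + 2w\<^sup>2 = 3 (u\<^sup>2 + 2n\<^sup>2)\<close>. The condition defining \<open>S\<close> fixes \<open>u\<^sup>2 + 2n\<^sup>2\<close>, and the one
  defining \<open>T\<close> fixes \<open>(6j + 1)\<^sup>2 + 2 (3k + 1)\<^sup>2\<close>, so \<open>T\<close> corresponds to the pairs with \<open>v = 6j + 1\<close> and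
  \<open>w = 3k + 1\<close>.

  Since \<open>n \<mapsto> -n\<close> preserves \<open>S\<close>, the weight \<open>u\<close> may be replaced by \<open>u + n = w\<close>. The numbers \<open>v\<close> and \<open>w\<close>
  are congruent modulo 3, and the sum splits by their class. The class of 1 is parametrised by \<open>T\<close>,
  negating both \<open>v\<close> and \<open>w\<close> maps the class of 2 to it with equal weights, and on the class of 0 the
  sum vanishes because \<open>v \<mapsto> -v\<close> is an involution that flips the sign \<open>(-1)\<^sup>m\<close> and keeps \<open>w\<close>.
\<close>

lemma ternary_exponent_sum:
  fixes N :: int
  defines "S \<equiv> {(n, m). n * n + 2 * (m * (m + 1)) = N}"
    and "T \<equiv> {(k, j). k * (3 * k + 2) + 2 * (j * (3 * j + 1)) = N}"
  assumes "finite S"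
  shows "(\<Sum>(n, m)\<in>S. alt m * (2 * m + 1)) = 2 * (\<Sum>(k, j)\<in>T. alt k * (3 * k + 1) * alt j)"
proof -
  define g where "g = (\<lambda>(n, m). alt m * (2 * m + 1 + n))"
  \<comment> \<open>as \<open>w = 3m + 1 - (m - n)\<close>, the classes 1, 0, 2 of \<open>w\<close> are \<open>A 0\<close>, \<open>A 1\<close>, \<open>A 2\<close>\<close>
  define A where "A r = S \<inter> {(n, m). (m - n) mod 3 = r}" for r
  have "(\<Sum>(n, m)\<in>S. alt m * n) = 0"
    by (rule sum_eq_0_by_involution[of _ "\<lambda>(n, m). (- n, m)"]) (auto simp: S_def)
  then have "(\<Sum>(n, m)\<in>S. alt m * (2 * m + 1)) = sum g S"
    by (simp add: g_def case_prod_unfold distrib_left sum.distrib)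
  also have "sum g S = sum g (A 0) + sum g (A 1) + sum g (A 2)"
  proof -
    have "S = A 0 \<union> A 1 \<union> A 2"
    proof -
      have "x mod 3 = 0 \<or> x mod 3 = 1 \<or> x mod 3 = 2" for x :: int by presburger
      then show ?thesis by (auto simp: A_def)
    qed
    moreover have "sum g (A 0 \<union> A 1 \<union> A 2) = sum g (A 0) + sum g (A 1) + sum g (A 2)"
      using \<open>finite S\<close> by (subst sum.union_disjoint; (subst sum.union_disjoint)?) (auto simp: A_def)
    ultimately show ?thesis by simp
  qed
  also have "sum g (A 1) = 0"
  proof (rule sum_eq_0_by_involution)
    \<comment> \<open>\<open>v \<mapsto> -v\<close> with \<open>w\<close> fixed, solved for \<open>n\<close> and \<open>m\<close>\<close>
    define h :: "int \<times> int \<Rightarrow> int \<times> int" where "h = (\<lambda>(n, m). ((4 * m + 2 - n) div 3, (m + 2 * n - 1) div 3))"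
    have h: "h (n, n + 1 + 3 * t) = (n + 2 + 4 * t, n + t)" for n t
    proof -
      have "4 * (n + 1 + 3 * t) + 2 - n = 3 * (n + 2 + 4 * t)" "n + 1 + 3 * t + 2 * n - 1 = 3 * (n + t)"
        by simp_all
      then show ?thesis by (simp only: h_def prod.case) simp
    qed
    fix x assume "x \<in> A 1"
    then obtain n m where x: "x = (n, m)" "(n, m) \<in> S" "(m - n) mod 3 = 1"
      by (auto simp: A_def)
    then obtain t where "m = n + 1 + 3 * t"
      using mult_div_mod_eq[of 3 "m - n"] by (metis add.assoc add.commute diff_add_cancel)
    with x have x: "x = (n, n + 1 + 3 * t)" "(n, n + 1 + 3 * t) \<in> S" by simp_all
    have "(n + 2 + 4 * t, n + t) \<in> S"
      using x(2) by (simp add: S_def algebra_simps)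
    moreover have "(n + t - (n + 2 + 4 * t)) mod 3 = 1" by presburger
    ultimately show "h x \<in> A 1" by (simp add: x h A_def)
    have "n + t = (n + 2 + 4 * t) + 1 + 3 * (- 1 - t)" by simp
    then have "h (n + 2 + 4 * t, n + t) = (n + 2 + 4 * t + 2 + 4 * (- 1 - t), n + 2 + 4 * t + (- 1 - t))"
      using h[of "n + 2 + 4 * t" "- 1 - t"] by simp
    then show "h (h x) = x" by (simp add: x h)
    show "g (h x) = - g x"
      by (simp add: x h g_def alt_add alt_3) (simp add: alt_def algebra_simps)
  qed
  also have "sum g (A 2) = sum g (A 0)"
  proof (rule sum.reindex_bij_witness[of _ "\<lambda>(n, m). (- n, - 1 - m)" "\<lambda>(n, m). (- n, - 1 - m)"])
    fix x assume "x \<in> A 2"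
    then show "(case x of (n, m) \<Rightarrow> (- n, - 1 - m)) \<in> A 0"
      by (auto simp: A_def S_def algebra_simps) presburger
  next
    fix x assume "x \<in> A 0"
    then show "(case x of (n, m) \<Rightarrow> (- n, - 1 - m)) \<in> A 2"
      by (auto simp: A_def S_def algebra_simps) presburger
  next
    fix x assume "x \<in> A 2"
    show "g (case x of (n, m) \<Rightarrow> (- n, - 1 - m)) = g x"
      by (cases x) (auto simp: g_def alt_def algebra_simps)
  qed auto
  also have "sum g (A 0) = (\<Sum>(k, j)\<in>T. alt k * (3 * k + 1) * alt j)"
  \<comment> \<open>from \<open>3n = w - v\<close> and \<open>3u = v + 2w\<close> with \<open>v = 6j + 1\<close>, \<open>w = 3k + 1\<close>\<close>
  proof (rule sum.reindex_bij_witness[of _ "\<lambda>(k, j). (k - 2 * j, k + j)" "\<lambda>(n, m). ((n + 2 * m) div 3, (m - n) div 3)"])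
    fix x assume "x \<in> A 0"
    then obtain n m where x: "x = (n, m)" "(n, m) \<in> S" "(m - n) mod 3 = 0"
      by (auto simp: A_def)
    define j k where "j = (m - n) div 3" and "k = n + 2 * j"
    have m: "m = k + j" "n = k - 2 * j"
      using x(3) by (auto simp: j_def k_def)
    have kj: "((n + 2 * m) div 3, (m - n) div 3) = (k, j)"
      by (simp add: m)
    show "(case case x of (n, m) \<Rightarrow> ((n + 2 * m) div 3, (m - n) div 3) of (k, j) \<Rightarrow> (k - 2 * j, k + j)) = x"
      by (simp only: x prod.case kj) (simp add: m)
    show "(case x of (n, m) \<Rightarrow> ((n + 2 * m) div 3, (m - n) div 3)) \<in> T"
    proof -
      have "n * n + 2 * (m * (m + 1)) = k * (3 * k + 2) + 2 * (j * (3 * j + 1))"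
        unfolding m by (simp add: algebra_simps)
      then show ?thesis
        using x(2) unfolding x(1) prod.case kj by (simp add: T_def S_def)
    qed
    show "(case case x of (n, m) \<Rightarrow> ((n + 2 * m) div 3, (m - n) div 3) of (k, j) \<Rightarrow> alt k * (3 * k + 1) * alt j) = g x"
      by (simp only: x prod.case kj) (simp add: g_def m alt_add algebra_simps)
  next
    fix y assume y: "y \<in> T"
    obtain k j where kj: "y = (k, j)" by (cases y)
    have "(k - 2 * j + 2 * (k + j)) = 3 * k" "k + j - (k - 2 * j) = 3 * j" by simp_all
    then show "(case case y of (k, j) \<Rightarrow> (k - 2 * j, k + j) of (n, m) \<Rightarrow> ((n + 2 * m) div 3, (m - n) div 3)) = y"
      by (simp only: kj prod.case) simp
    show "(case y of (k, j) \<Rightarrow> (k - 2 * j, k + j)) \<in> A 0"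
      using y by (simp add: kj A_def S_def T_def algebra_simps)
  qed
  finally show ?thesis by simp
qed

text \<open>
  The series \<open>Y\<close>; its exponents are the generalised octagonal numbers.
\<close>

definition octagonal_theta :: "int fps" where
  "octagonal_theta = theta (\<lambda>k. alt k * (3 * k + 1)) (\<lambda>k. nat (k * (3 * k + 2)))"

text \<open>
  Both sides, doubled, are double theta series: \<open>E\<^sub>4\<close> on the left is expanded by the pentagonal number
  theorem, and on the right \<open>\<Sum> q\<^bsup>n\<^sup>2\<^esup> = E\<^sub>2 O\<^sub>+\<^sup>2\<close> and \<open>2 E\<^sub>4\<^sup>3\<close> are expanded by Gauss and Jacobi. Their coefficients
  are the two sums of lemma \<open>ternary_exponent_sum\<close>.
\<close>

lemma octagonal_theta_mult_euler_4:
  "octagonal_theta * euler 4 = euler 2 * odd_plus ^ 2 * euler 4 ^ 3"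
proof -
  have "2 * (octagonal_theta * euler 4) = theta (\<lambda>_. 1) (\<lambda>n. nat (n * n)) * (2 * euler 4 ^ 3)"
  proof (rule fps_ext)
    fix N
    have 4: "4 * int (nat x) = 2 * (2 * int (nat x))" for x by simp
    have S: "(case p of (n, m) \<Rightarrow> nat (n * n) + 4 * nat (m * (m + 1) div 2) = N) \<longleftrightarrow>
        (case p of (n, m) \<Rightarrow> n * n + 2 * (m * (m + 1)) = int N)" for p :: "int \<times> int"
    proof -
      obtain n m where p: "p = (n, m)" by (cases p)
      have "int (nat (n * n) + 4 * nat (m * (m + 1) div 2)) = n * n + 2 * (m * (m + 1))"
        unfolding of_nat_add of_nat_mult of_nat_numeral 4 int_half_consecutive by simp
      then show ?thesis unfolding p prod.case by (metis of_nat_eq_iff)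
    qed
    have T: "(case p of (k, j) \<Rightarrow> nat (k * (3 * k + 2)) + 4 * nat (j * (3 * j + 1) div 2) = N) \<longleftrightarrow>
        (case p of (k, j) \<Rightarrow> k * (3 * k + 2) + 2 * (j * (3 * j + 1)) = int N)" for p :: "int \<times> int"
    proof -
      obtain k j where p: "p = (k, j)" by (cases p)
      have "int (nat (k * (3 * k + 2)) + 4 * nat (j * (3 * j + 1) div 2)) = k * (3 * k + 2) + 2 * (j * (3 * j + 1))"
        unfolding of_nat_add of_nat_mult of_nat_numeral 4 int_pentagonal int_octagonal by simp
      then show ?thesis unfolding p prod.case by (metis of_nat_eq_iff)
    qed
    have "(2 * (octagonal_theta * euler 4)) $ N = 2 * (octagonal_theta * euler 4) $ N"
      by (simp only: mult_2 fps_add_nth)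
    also have "(octagonal_theta * euler 4) $ N = (\<Sum>(k, j) | nat (k * (3 * k + 2)) + 4 * nat (j * (3 * j + 1) div 2) = N.
        alt k * (3 * k + 1) * alt j)"
      unfolding octagonal_theta_def pentagonal_number_theorem[of 4, OF zero_less_numeral, symmetric]
      by (rule theta_mult_nth(1)[OF finite_fibres(4)[OF zero_less_one] finite_fibres(3)[OF zero_less_numeral]])
    also have "2 * \<dots> = (\<Sum>(n, m) | nat (n * n) + 4 * nat (m * (m + 1) div 2) = N. alt m * (2 * m + 1))"
      unfolding S T
    proof (rule ternary_exponent_sum[symmetric])
      show "finite {(n, m). n * n + 2 * (m * (m + 1)) = int N}"
        unfolding S[symmetric]
        by (rule theta_mult_nth(2)[OF finite_fibres(1)[OF zero_less_one] finite_fibres(2)[OF zero_less_numeral]])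
    qed
    also have "\<dots> = (theta (\<lambda>_. 1) (\<lambda>n. nat (n * n)) * theta (\<lambda>j. alt j * (2 * j + 1)) (\<lambda>j. 4 * nat (j * (j + 1) div 2))) $ N"
      unfolding theta_mult_nth(1)[OF finite_fibres(1)[OF zero_less_one] finite_fibres(2)[OF zero_less_numeral]]
      by simp
    also have "\<dots> = (theta (\<lambda>_. 1) (\<lambda>n. nat (n * n)) * (2 * euler 4 ^ 3)) $ N"
      unfolding jacobi_cube[of 4, OF zero_less_numeral] ..
    finally show "(2 * (octagonal_theta * euler 4)) $ N = (theta (\<lambda>_. 1) (\<lambda>n. nat (n * n)) * (2 * euler 4 ^ 3)) $ N" .
  qed
  then show ?thesis unfolding gauss_theta by (simp add: mult_ac)
qed

lemma octagonal_theta_eq: "euler 1 ^ 2 * octagonal_theta = euler 2 ^ 5"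
proof -
  have "octagonal_theta * euler 4 = (euler 2 * odd_plus ^ 2 * euler 4 ^ 2) * euler 4"
    unfolding octagonal_theta_mult_euler_4 by (simp add: power2_eq_square power3_eq_cube mult_ac)
  then have "octagonal_theta = euler 2 * odd_plus ^ 2 * euler 4 ^ 2"
    by simp
  then have "euler 1 ^ 2 * octagonal_theta = euler 2 ^ 3 * (odd_plus * odd_minus * euler 4) ^ 2"
    unfolding odd_minus_mult_euler[symmetric]
    by (simp add: power_mult_distrib power3_eq_cube power2_eq_square mult_ac)
  also have "\<dots> = euler 2 ^ 5"
    unfolding odd_plus_mult_odd_minus_mult_euler by (simp flip: power_add)
  finally show ?thesis .
qed

section \<open>Brackets of theta series\<close>

lemma qderiv_odd_minus_5:
  "3 * (qderiv (euler 1) * euler 2 ^ 3) - euler 1 * qderiv (euler 2 ^ 3) = 3 * (qderiv odd_minus * euler 2 ^ 4)"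
  unfolding odd_minus_mult_euler[symmetric] qderiv_power
  by (simp add: qderiv_mult power_numeral_reduce algebra_simps)

text \<open>
  Differentiating \<open>E\<^sub>1\<^sup>2 Y = E\<^sub>2\<^sup>5\<close> expresses \<open>E\<^sub>1\<^sup>2 D(Y)\<close> through \<open>D(E\<^sub>1)\<close> and \<open>D(E\<^sub>2)\<close>; the bracket becomes
  \<open>5 E\<^sub>2\<^sup>4 (D(E\<^sub>1) E\<^sub>2 - E\<^sub>1 D(E\<^sub>2))\<close>, and the last factor is \<open>D(O\<^sub>-) E\<^sub>2\<^sup>2\<close> as \<open>E\<^sub>1 = O\<^sub>- E\<^sub>2\<close>.
\<close>

lemma qderiv_odd_minus_7:
  "qderiv (euler 1 ^ 3) * octagonal_theta - euler 1 ^ 3 * qderiv octagonal_theta = 5 * (qderiv odd_minus * euler 2 ^ 6)"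
proof -
  let ?a = "euler 1" and ?b = "euler 2" and ?y = octagonal_theta
  have "2 * ?a * qderiv ?a * ?y + ?a ^ 2 * qderiv ?y = 5 * ?b ^ 4 * qderiv ?b"
    using arg_cong[OF octagonal_theta_eq, of qderiv] by (simp add: qderiv_mult qderiv_power mult_ac add.commute)
  then have y': "?a ^ 2 * qderiv ?y = 5 * ?b ^ 4 * qderiv ?b - 2 * ?a * qderiv ?a * ?y"
    by (simp only: eq_diff_eq add.commute)
  have "qderiv (?a ^ 3) * ?y - ?a ^ 3 * qderiv ?y = 3 * qderiv ?a * (?a ^ 2 * ?y) - ?a * (?a ^ 2 * qderiv ?y)"
    unfolding qderiv_power by (simp add: power3_eq_cube power2_eq_square mult_ac)
  also have "\<dots> = 3 * qderiv ?a * (?a ^ 2 * ?y) + 2 * qderiv ?a * (?a ^ 2 * ?y) - 5 * ?a * ?b ^ 4 * qderiv ?b"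
    unfolding y' by (simp add: algebra_simps power2_eq_square)
  also have "\<dots> = 5 * (qderiv ?a * ?b ^ 5) - 5 * ?a * ?b ^ 4 * qderiv ?b"
    unfolding octagonal_theta_eq by simp
  also have "\<dots> = 5 * (qderiv odd_minus * ?b ^ 6)"
    unfolding odd_minus_mult_euler[symmetric]
    by (simp add: qderiv_mult power_numeral_reduce algebra_simps)
  finally show ?thesis .
qed

section \<open>Transfer of congruences along a p-th power\<close>

text \<open>
  From \<open>D(h\<^sup>p) = p h\<^sup>p\<^sup>-\<^sup>1 D(h)\<close> the prime divides \<open>n\<close> times the coefficient of index \<open>n\<close>.
\<close>

lemma prime_dvd_power_nth:
  fixes h :: "int fps"
  assumes "prime p" "\<not> p dvd n"
  shows "int p dvd (h ^ p) $ n"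
proof -
  have "int n * (h ^ p) $ n = qderiv (h ^ p) $ n"
    by simp
  also have "\<dots> = int p * (h ^ (p - 1) * qderiv h) $ n"
    unfolding qderiv_power mult.assoc fps_of_nat[symmetric] fps_mult_left_const_nth by simp
  finally have "int p dvd int n * (h ^ p) $ n" by simp
  moreover have "coprime (int p) (int n)"
    using assms by (simp add: prime_imp_coprime)
  ultimately show ?thesis
    by (simp add: coprime_dvd_mult_right_iff)
qed

text \<open>
  Modulo \<open>p\<close>, the coefficient of index \<open>n\<close> of \<open>f h\<close> is that of \<open>f\<close> plus a combination of earlier
  coefficients of \<open>f\<close> with indices congruent to \<open>n\<close>, which vanish by induction.
\<close>

lemma dvd_nth_of_dvd_mult_nth:
  fixes f h :: "int fps"
  assumes prod: "\<And>n. n mod p = r \<Longrightarrow> int p dvd (f * h) $ n"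
    and h: "\<And>n. \<not> p dvd n \<Longrightarrow> int p dvd h $ n" and "h $ 0 = 1"
    and "n mod p = r"
  shows "int p dvd f $ n"
  using \<open>n mod p = r\<close>
proof (induction n rule: less_induct)
  case (less n)
  have "(f * h) $ n = (\<Sum>i<n. f $ i * h $ (n - i)) + f $ n"
    unfolding fps_mult_nth atLeast0AtMost lessThan_Suc_atMost[symmetric] using \<open>h $ 0 = 1\<close> by simp
  moreover have "int p dvd (\<Sum>i<n. f $ i * h $ (n - i))"
  proof (rule dvd_sum)
    fix i assume i: "i \<in> {..<n}"
    show "int p dvd f $ i * h $ (n - i)"
    proof (cases "p dvd n - i")
      case True
      then have "i mod p = r"
        using i less.prems by (metis lessThan_iff less_imp_le_nat mod_eq_dvd_iff_nat)
      then show ?thesis using less.IH i by simp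
    next
      case False
      then show ?thesis using h by simp
    qed
  qed
  ultimately show ?case using prod[OF less.prems] by (simp add: dvd_add_right_iff)
qed

section \<open>The generating function\<close>

text \<open>The bound \<open>2 m\<close> on the parts makes room for an induction that adds one part size at a time.\<close>

definition even_partitions :: "nat \<Rightarrow> nat \<Rightarrow> nat multiset set" where
  "even_partitions m n = {R. is_partition R n \<and> (\<forall>k\<in>#R. even k \<and> k \<le> 2 * m)}"

lemma finite_even_partitions: "finite (even_partitions m n)"
proof (rule finite_subset[OF _ finite_partitions_no_rep_odd])
  show "even_partitions m n \<subseteq> partitions_no_rep_odd n"
  proof
    fix R assume R: "R \<in> even_partitions m n"
    have "count R k \<le> 1" if "odd k" for k
    proof -
      have "k \<notin># R" using R that by (auto simp: even_partitions_def)
      then show ?thesis by (simp add: not_in_iff)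
    qed
    then show "R \<in> partitions_no_rep_odd n"
      using R by (auto simp: even_partitions_def partitions_no_rep_odd_def)
  qed
qed

lemma part_le: "is_partition R n \<Longrightarrow> k \<in># R \<Longrightarrow> k \<le> n"
  by (auto simp: is_partition_def dest!: multi_member_split)

lemma even_partitions_stable: "n \<le> m \<Longrightarrow> even_partitions m n = even_partitions n n"
  using part_le by (fastforce simp: even_partitions_def)

lemma even_partitions_odd: "odd n \<Longrightarrow> even_partitions m n = {}"
proof (rule ccontr)
  assume "odd n" "even_partitions m n \<noteq> {}"
  then obtain R where R: "sum_mset R = n" "\<forall>k\<in>#R. even k"
    by (auto simp: even_partitions_def is_partition_def)
  from R(2) have "even (sum_mset R)" by (induction R) auto
  with R \<open>odd n\<close> show False by simp
qed

lemma even_partitions_0: "even_partitions 0 n = (if n = 0 then {{#}} else {})"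
proof -
  have "R = {#} \<and> n = 0" if "R \<in> even_partitions 0 n" for R
    using that by (cases R) (auto simp: even_partitions_def is_partition_def)
  moreover have "{#} \<in> even_partitions 0 0"
    by (simp add: even_partitions_def is_partition_def)
  ultimately show ?thesis by auto
qed

text \<open>
  A partition that contains the new part \<open>k\<close> is a partition of \<open>n - k\<close> with one copy of \<open>k\<close> added. On
  generating functions the recursion is multiplication by \<open>1 - q\<^sup>k\<close>.
\<close>

lemma card_even_partitions_Suc:
  fixes m n :: nat
  defines "k \<equiv> 2 * Suc m"
  shows "card (even_partitions (Suc m) n) =
    card (even_partitions m n) + (if k \<le> n then card (even_partitions (Suc m) (n - k)) else 0)"
proof -
  define W where "W = {R \<in> even_partitions (Suc m) n. k \<in># R}"
  have "even_partitions (Suc m) n = even_partitions m n \<union> W"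
  proof -
    have "i \<le> 2 * m" if "even i" "i \<le> 2 * Suc m" "i \<noteq> k" for i
      using that unfolding k_def by presburger
    then show ?thesis
      by (auto simp: even_partitions_def W_def)
  qed
  moreover have "even_partitions m n \<inter> W = {}"
    by (auto simp: even_partitions_def W_def k_def)
  moreover have "finite W"
    unfolding W_def using finite_even_partitions by simp
  ultimately have "card (even_partitions (Suc m) n) = card (even_partitions m n) + card W"
    by (simp add: card_Un_disjoint finite_even_partitions)
  moreover have "card W = (if k \<le> n then card (even_partitions (Suc m) (n - k)) else 0)"
  proof (cases "k \<le> n")
    case True
    have "bij_betw (add_mset k) (even_partitions (Suc m) (n - k)) W"
    proof (rule bij_betwI[where g = "\<lambda>R. R - {#k#}"])
      show "add_mset k \<in> even_partitions (Suc m) (n - k) \<rightarrow> W"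
        using True by (auto simp: even_partitions_def is_partition_def W_def k_def)
      show "(\<lambda>R. R - {#k#}) \<in> W \<rightarrow> even_partitions (Suc m) (n - k)"
        by (auto simp: even_partitions_def is_partition_def W_def dest!: multi_member_split)
    qed (auto simp: W_def)
    then show ?thesis using True by (simp add: bij_betw_same_card)
  next
    case False
    then have "W = {}"
      using part_le by (fastforce simp: W_def even_partitions_def)
    then show ?thesis using False by simp
  qed
  ultimately show ?thesis by simp
qed

definition even_series :: "nat \<Rightarrow> int fps" where
  "even_series m = Abs_fps (\<lambda>n. int (card (even_partitions m n)))"

lemma even_series_mult_qfact: "even_series m * qfact (fps_X ^ 2) m = 1"
proof (induction m)
  case 0
  have "even_series 0 = 1"
    by (rule fps_ext) (simp add: even_series_def even_partitions_0)
  then show ?case by simp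
next
  case (Suc m)
  have "even_series (Suc m) * (1 - fps_X ^ (2 * Suc m)) = even_series m"
  proof (rule fps_ext)
    fix n
    show "(even_series (Suc m) * (1 - fps_X ^ (2 * Suc m))) $ n = even_series m $ n"
      unfolding right_diff_distrib fps_sub_nth fps_X_power_mult_right_nth
      using card_even_partitions_Suc[of m n] by (simp add: even_series_def)
  qed
  moreover have "even_series (Suc m) * qfact (fps_X ^ 2) (Suc m)
      = (even_series (Suc m) * (1 - fps_X ^ (2 * Suc m))) * qfact (fps_X ^ 2) m"
    unfolding qfact_Suc power_mult[symmetric] by (simp only: mult_ac)
  ultimately show ?case using Suc by simp
qed

definition even_partition_series :: "int fps" where
  "even_partition_series = Abs_fps (\<lambda>n. int (card (even_partitions n n)))"

lemma even_partition_series_mult_euler: "even_partition_series * euler 2 = 1"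
proof (rule LIMSEQ_unique)
  show "(\<lambda>m. even_series m * qfact (fps_X ^ 2) m) \<longlonglongrightarrow> even_partition_series * euler 2"
  proof (rule tendsto_fps_mult)
    show "even_series \<longlonglongrightarrow> even_partition_series"
    proof (rule tendsto_fpsI)
      fix n
      show "\<forall>\<^sub>F m in sequentially. even_series m $ n = even_partition_series $ n"
        using eventually_ge_at_top[of n]
      proof eventually_elim
        case (elim m)
        then show ?case
          using even_partitions_stable[of n m] by (simp add: even_series_def even_partition_series_def)
      qed
    qed
  qed (rule euler_tendsto, simp)
  show "(\<lambda>m. even_series m * qfact (fps_X ^ 2) m) \<longlonglongrightarrow> 1"
    unfolding even_series_mult_qfact by (rule tendsto_const)
qed

definition odd_sets :: "nat \<Rightarrow> nat set set" where
  "odd_sets a = {S. finite S \<and> (\<forall>k\<in>S. odd k) \<and> \<Sum>S = a}"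

lemma mem_odd_sets_le: "S \<in> odd_sets a \<Longrightarrow> k \<in> S \<Longrightarrow> k \<le> a"
  unfolding odd_sets_def using member_le_sum[of k S "\<lambda>x. x"] by blast

lemma finite_odd_sets: "finite (odd_sets a)"
proof (rule finite_subset)
  show "odd_sets a \<subseteq> Pow {..a}" using mem_odd_sets_le by auto
qed simp

text \<open>
  Expanding the product gives the sign \<open>(-1)\<^sup>|\<^sup>S\<^sup>|\<close> to a set \<open>S\<close> of odd numbers, and \<open>|S|\<close> has the parity
  of the sum of \<open>S\<close>.
\<close>

lemma odd_minus_nth: "odd_minus $ a = (- 1) ^ a * int (card (odd_sets a))"
proof -
  define A where "A = (\<lambda>i. 2 * i + 1) ` {..<a}"
  have A: "finite A" by (simp add: A_def)
  have sgn: "even (card S) = even (\<Sum>S)" if "finite S" "\<forall>k\<in>S. odd k" for S :: "nat set"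
    using that by (induction S rule: finite_induct) auto
  have "odd_minus $ a = (\<Prod>i<a. 1 - fps_X ^ (2 * i + 1)) $ a"
    by (simp add: odd_minus_def infprod_def)
  also have "(\<Prod>i<a. 1 - fps_X ^ (2 * i + 1)) = (\<Prod>k\<in>A. - (fps_X ^ k) + 1 :: int fps)"
    unfolding A_def by (subst prod.reindex) (auto simp: inj_on_def)
  also have "\<dots> = (\<Sum>S\<in>Pow A. \<Prod>k\<in>S. - (fps_X ^ k))"
    using A by (subst prod_add) auto
  also have "\<dots> = (\<Sum>S\<in>Pow A. fps_const ((- 1) ^ card S) * fps_X ^ (\<Sum>S))"
  proof (intro sum.cong refl)
    fix S assume "S \<in> Pow A"
    have "(\<Prod>k\<in>S. - (fps_X ^ k :: int fps)) = (\<Prod>k\<in>S. - 1) * (\<Prod>k\<in>S. fps_X ^ k)"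
      unfolding prod.distrib[symmetric] by simp
    also have "\<dots> = (- 1) ^ card S * fps_X ^ (\<Sum>S)"
      by (simp add: power_sum)
    also have "(- 1) ^ card S = (fps_const ((- 1) ^ card S) :: int fps)"
      by (simp add: minus_one_power_iff flip: fps_const_neg)
    finally show "(\<Prod>k\<in>S. - (fps_X ^ k :: int fps)) = fps_const ((- 1) ^ card S) * fps_X ^ (\<Sum>S)" .
  qed
  also have "\<dots> $ a = (\<Sum>S\<in>Pow A. if \<Sum>S = a then (- 1) ^ card S else 0)"
    unfolding fps_sum_nth fps_mult_left_const_nth fps_X_power_nth by (intro sum.cong) auto
  also have "\<dots> = (\<Sum>S\<in>{S \<in> Pow A. \<Sum>S = a}. (- 1) ^ card S)"
    by (rule sum.inter_filter[symmetric]) (simp add: A)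
  also have "{S \<in> Pow A. \<Sum>S = a} = odd_sets a"
  proof (intro equalityI subsetI)
    fix S assume "S \<in> {S \<in> Pow A. \<Sum>S = a}"
    then have "S \<subseteq> A" "\<Sum>S = a" by auto
    then show "S \<in> odd_sets a"
      using A finite_subset[of S A] by (auto simp: odd_sets_def A_def)
  next
    fix S assume S: "S \<in> odd_sets a"
    have "k \<in> A" if "k \<in> S" for k
    proof -
      have "odd k" using S that by (auto simp: odd_sets_def)
      then obtain i where "k = 2 * i + 1" by (elim oddE)
      moreover have "k \<le> a" using S that by (rule mem_odd_sets_le)
      ultimately show ?thesis by (auto simp: A_def)
    qed
    then show "S \<in> {S \<in> Pow A. \<Sum>S = a}" using S by (auto simp: odd_sets_def)
  qed
  also have "(\<Sum>S\<in>odd_sets a. (- 1) ^ card S) = (\<Sum>S\<in>odd_sets a. (- 1 :: int) ^ a)"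
    by (intro sum.cong refl) (auto simp: odd_sets_def minus_one_power_iff sgn)
  also have "\<dots> = (- 1) ^ a * int (card (odd_sets a))"
    by simp
  finally show ?thesis .
qed

text \<open>
  A partition without repeated odd parts corresponds to the set of its odd parts together with the partition
  formed by its even parts.
\<close>

lemma SODO_convolution:
  "SODO n = (\<Sum>a=0..n. a * card (odd_sets a) * card (even_partitions (n - a) (n - a)))"
proof -
  have "SODO n = (\<Sum>(a, S, R)\<in>(SIGMA a:{0..n}. odd_sets a \<times> even_partitions (n - a) (n - a)). a)"
    unfolding SODO_def
  proof (rule sum.reindex_bij_witness[of _ "\<lambda>(a, S, R). mset_set S + R"
      "\<lambda>P. (sum_mset (filter_mset odd P), set_mset (filter_mset odd P), filter_mset even P)"])
    fix P assume P: "P \<in> partitions_no_rep_odd n"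
    have simple: "mset_set (set_mset (filter_mset odd P)) = filter_mset odd P"
    proof (rule multiset_eqI)
      fix k
      have "odd k \<Longrightarrow> count P k \<le> 1" using P by (simp add: partitions_no_rep_odd_def)
      then show "count (mset_set (set_mset (filter_mset odd P))) k = count (filter_mset odd P) k"
        by (auto simp: count_mset_set' not_in_iff) (metis One_nat_def Suc_leI count_greater_zero_iff le_antisym)
    qed
    have split: "P = filter_mset odd P + filter_mset even P"
      using multiset_partition[of P odd] by simp
    show "(case (sum_mset (filter_mset odd P), set_mset (filter_mset odd P), filter_mset even P) of
        (a, S, R) \<Rightarrow> mset_set S + R) = P"
      unfolding prod.case simple by (rule split[symmetric])
    have "sum_mset (filter_mset odd P) + sum_mset (filter_mset even P) = sum_mset P"
      unfolding sum_mset.union[symmetric] split[symmetric] ..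
    then have sum: "sum_mset (filter_mset odd P) + sum_mset (filter_mset even P) = n"
      using P by (simp add: partitions_no_rep_odd_def is_partition_def)
    have "\<Sum>(set_mset (filter_mset odd P)) = sum_mset (filter_mset odd P)"
      unfolding sum_unfold_sum_mset simple by simp
    then have "set_mset (filter_mset odd P) \<in> odd_sets (sum_mset (filter_mset odd P))"
      by (auto simp: odd_sets_def)
    moreover have "is_partition (filter_mset even P) (n - sum_mset (filter_mset odd P))"
      using P sum by (auto simp: partitions_no_rep_odd_def is_partition_def)
    then have "filter_mset even P \<in> even_partitions (n - sum_mset (filter_mset odd P)) (n - sum_mset (filter_mset odd P))"
      using part_le by (fastforce simp: even_partitions_def)
    ultimately show "(sum_mset (filter_mset odd P), set_mset (filter_mset odd P), filter_mset even P)
        \<in> (SIGMA a:{0..n}. odd_sets a \<times> even_partitions (n - a) (n - a))"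
      using sum by auto
  next
    fix x assume x: "x \<in> (SIGMA a:{0..n}. odd_sets a \<times> even_partitions (n - a) (n - a))"
    obtain a S R where asr: "x = (a, S, R)" by (cases x)
    have a: "a \<le> n" and S: "finite S" "\<forall>k\<in>S. odd k" "\<Sum>S = a"
      and R: "is_partition R (n - a)" "\<forall>k\<in>#R. even k"
      using x by (auto simp: asr odd_sets_def even_partitions_def)
    have fR: "filter_mset odd R = {#}" "filter_mset even R = R"
      using R(2) by (auto simp: filter_mset_eq_conv)
    have fS: "filter_mset odd (mset_set S) = mset_set S" "filter_mset even (mset_set S) = {#}"
    proof -
      have "{k \<in> S. odd k} = S" "{k \<in> S. even k} = {}" using S(2) by auto
      then show "filter_mset odd (mset_set S) = mset_set S" "filter_mset even (mset_set S) = {#}"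
        unfolding filter_mset_mset_set[OF S(1)] by (simp_all only: mset_set.empty)
    qed
    have sumS: "sum_mset (mset_set S) = a"
      using S(3) by (simp add: sum_unfold_sum_mset)
    show "(sum_mset (filter_mset odd (case x of (a, S, R) \<Rightarrow> mset_set S + R)),
        set_mset (filter_mset odd (case x of (a, S, R) \<Rightarrow> mset_set S + R)),
        filter_mset even (case x of (a, S, R) \<Rightarrow> mset_set S + R)) = x"
      unfolding asr prod.case filter_union_mset fR fS using S(1) sumS by simp
    have "k > 0" if "k \<in> S" for k using S(2) that by (auto intro: odd_pos)
    moreover have "count R k = 0" if "odd k" for k
      using R(2) that by (auto simp flip: not_in_iff)
    ultimately show "(case x of (a, S, R) \<Rightarrow> mset_set S + R) \<in> partitions_no_rep_odd n"
      using a S R sumS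
      by (auto simp: asr partitions_no_rep_odd_def is_partition_def count_mset_set')
  qed auto
  also have "\<dots> = (\<Sum>a=0..n. \<Sum>(S, R)\<in>odd_sets a \<times> even_partitions (n - a) (n - a). a)"
    by (subst sum.Sigma) (auto simp: finite_odd_sets finite_even_partitions case_prod_unfold)
  also have "\<dots> = (\<Sum>a=0..n. a * card (odd_sets a) * card (even_partitions (n - a) (n - a)))"
    by (simp add: case_prod_unfold card_cartesian_product mult_ac)
  finally show ?thesis .
qed

text \<open>
  The signs realise the substitution of \<open>-q\<close> for \<open>q\<close>.
\<close>

definition SODO_series :: "int fps" where
  "SODO_series = Abs_fps (\<lambda>n. (- 1) ^ n * int (SODO n))"

text \<open>
  The sign \<open>(-1)\<^sup>n\<close> of a partition of \<open>n\<close> depends only on its odd parts, so it is absorbed by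
  \<open>O\<^sub>-\<close>, and the even parts contribute \<open>1 / E\<^sub>2\<close> unchanged.
\<close>

lemma SODO_series_mult_euler: "SODO_series * euler 2 = qderiv odd_minus"
proof -
  have "SODO_series = qderiv odd_minus * even_partition_series"
  proof (rule fps_ext)
    fix n
    have key: "int a * ((- 1) ^ a * int (card (odd_sets a))) * int (card (even_partitions (n - a) (n - a)))
        = (- 1) ^ n * int (a * card (odd_sets a) * card (even_partitions (n - a) (n - a)))" if "a \<le> n" for a
    proof (cases "even (n - a)")
      case True
      then have "even a = even n" using that by simp
      then show ?thesis by (simp add: minus_one_power_iff)
    next
      case False
      then show ?thesis by (simp add: even_partitions_odd)
    qed
    have "SODO_series $ n = (\<Sum>a=0..n. (- 1) ^ n * int (a * card (odd_sets a) * card (even_partitions (n - a) (n - a))))"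
      by (simp add: SODO_series_def SODO_convolution sum_distrib_left)
    also have "\<dots> = (\<Sum>a=0..n. int a * ((- 1) ^ a * int (card (odd_sets a))) * int (card (even_partitions (n - a) (n - a))))"
      by (intro sum.cong refl key[symmetric]) simp
    also have "\<dots> = (qderiv odd_minus * even_partition_series) $ n"
      by (simp add: fps_mult_nth odd_minus_nth even_partition_series_def)
    finally show "SODO_series $ n = (qderiv odd_minus * even_partition_series) $ n" .
  qed
  then show ?thesis
    using even_partition_series_mult_euler by (metis mult.assoc mult_1_right)
qed

lemma dvd_SODO:
  assumes "prime p" "\<And>n. n mod p = r \<Longrightarrow> int p dvd (qderiv odd_minus * euler 2 ^ (p - 1)) $ n"
    and "n mod p = r"
  shows "[SODO n = 0] (mod p)"
proof -
  have "p > 0" using assms(1) by (simp add: prime_gt_0_nat)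
  have eq: "SODO_series * euler 2 ^ p = qderiv odd_minus * euler 2 ^ (p - 1)"
    unfolding SODO_series_mult_euler[symmetric] mult.assoc power_Suc[symmetric] using \<open>p > 0\<close> by simp
  have "int p dvd SODO_series $ n"
  proof (rule dvd_nth_of_dvd_mult_nth[of p r _ "euler 2 ^ p"])
    show "int p dvd (euler 2 ^ p) $ k" if "\<not> p dvd k" for k
      using assms(1) that by (rule prime_dvd_power_nth)
    show "int p dvd (SODO_series * euler 2 ^ p) $ k" if "k mod p = r" for k
      unfolding eq using that by (rule assms(2))
  qed (simp_all add: fps_power_zeroth assms(3))
  then have "int p dvd int (SODO n)"
    by (simp add: SODO_series_def minus_one_power_iff split: if_splits)
  then show ?thesis by (simp add: cong_0_iff)
qed

section \<open>Termwise divisibility and the congruences\<close>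

text \<open>
  With \<open>e = i (3i + 1) / 2\<close> and \<open>d = j (j + 1)\<close>, the hypothesis \<open>2 (e + d) \<equiv> 0\<close> reads
  \<open>(6i + 1)\<^sup>2 + 6 (2j + 1)\<^sup>2 \<equiv> 7\<close>, that is, two squares add up to 2 modulo 5. Both squares are
  then 1, so that \<open>e \<equiv> d \<equiv> 0\<close>. The proof runs through the residues.
\<close>

lemma dvd_5_quadratic:
  fixes i j :: int
  assumes "5 dvd i * (3 * i + 1) + 2 * (j * (j + 1))"
  shows "5 dvd (3 * (i * (3 * i + 1)) - 2 * (j * (j + 1))) * (2 * j + 1)"
proof -
  define r s where "r = i mod 5" and "s = j mod 5"
  have 1: "(i * (3 * i + 1) + 2 * (j * (j + 1))) mod 5 = (r * (3 * r + 1) + 2 * (s * (s + 1))) mod 5"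
    unfolding r_def s_def by (intro mod_add_cong mod_mult_cong mod_diff_cong refl mod_mod_trivial[symmetric])
  have 2: "((3 * (i * (3 * i + 1)) - 2 * (j * (j + 1))) * (2 * j + 1)) mod 5
      = ((3 * (r * (3 * r + 1)) - 2 * (s * (s + 1))) * (2 * s + 1)) mod 5"
    unfolding r_def s_def by (intro mod_add_cong mod_mult_cong mod_diff_cong refl mod_mod_trivial[symmetric])
  have "x mod 5 \<in> {0, 1, 2, 3, 4}" for x :: int
    unfolding insert_iff empty_iff by presburger
  then have "r \<in> {0, 1, 2, 3, 4}" "s \<in> {0, 1, 2, 3, 4}"
    unfolding r_def s_def by blast+
  then show ?thesis
    using assms unfolding dvd_eq_mod_eq_0 1 2 by auto
qed

text \<open>
  With \<open>e = i (i + 1) / 2\<close> and \<open>d = j (3j + 2)\<close>, the residues of \<open>x = 2i + 1\<close> and \<open>y = 3j + 1\<close> satisfy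
  \<open>3 x\<^sup>2 + y\<^sup>2 \<equiv> 3 (e + d) + 4\<close> modulo 7. For \<open>e + d \<equiv> 0\<close> and \<open>e + d \<equiv> 2\<close> the squares modulo 7 leave only
  solutions with \<open>x \<equiv> 0\<close>, \<open>y \<equiv> 0\<close> or \<open>e \<equiv> d\<close>.
\<close>

lemma dvd_7_quadratic:
  fixes i j :: int
  assumes "7 dvd i * (i + 1) + 2 * (j * (3 * j + 2)) \<or> 7 dvd i * (i + 1) + 2 * (j * (3 * j + 2)) - 4"
  shows "7 dvd (i * (i + 1) - 2 * (j * (3 * j + 2))) * ((2 * i + 1) * (3 * j + 1))"
proof -
  define r s where "r = i mod 7" and "s = j mod 7"
  have 1: "(i * (i + 1) + 2 * (j * (3 * j + 2))) mod 7 = (r * (r + 1) + 2 * (s * (3 * s + 2))) mod 7"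
    unfolding r_def s_def by (intro mod_add_cong mod_mult_cong mod_diff_cong refl mod_mod_trivial[symmetric])
  have 2: "(i * (i + 1) + 2 * (j * (3 * j + 2)) - 4) mod 7 = (r * (r + 1) + 2 * (s * (3 * s + 2)) - 4) mod 7"
    unfolding r_def s_def by (intro mod_add_cong mod_mult_cong mod_diff_cong refl mod_mod_trivial[symmetric])
  have 3: "((i * (i + 1) - 2 * (j * (3 * j + 2))) * ((2 * i + 1) * (3 * j + 1))) mod 7
      = ((r * (r + 1) - 2 * (s * (3 * s + 2))) * ((2 * r + 1) * (3 * s + 1))) mod 7"
    unfolding r_def s_def by (intro mod_add_cong mod_mult_cong mod_diff_cong refl mod_mod_trivial[symmetric])
  have "x mod 7 \<in> {0, 1, 2, 3, 4, 5, 6}" for x :: int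
    unfolding insert_iff empty_iff by presburger
  then have "r \<in> {0, 1, 2, 3, 4, 5, 6}" "s \<in> {0, 1, 2, 3, 4, 5, 6}"
    unfolding r_def s_def by blast+
  then show ?thesis
    using assms unfolding dvd_eq_mod_eq_0 1 2 3 by auto
qed

lemma qderiv_double: "qderiv (2 * f) = 2 * qderiv f"
  unfolding mult_2 by (simp add: qderiv_def distrib_left)

lemma numeral_mult_nth: "(numeral k * f) $ n = numeral k * (f $ n :: 'a::comm_ring_1)"
  by (simp only: numeral_fps_const fps_mult_left_const_nth)

text \<open>
  The bracket is taken with \<open>2 E\<^sub>2\<^sup>3\<close>, whose expansion has integer weights over all integers; this accounts
  for the factor 6 instead of 3, which is prime to 5.
\<close>

lemma dvd_5_nth:
  assumes "n mod 5 = 0"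
  shows "int 5 dvd (qderiv odd_minus * euler 2 ^ (5 - 1)) $ n"
proof -
  let ?e = "\<lambda>i::int. 1 * nat (i * (3 * i + 1) div 2)" and ?d = "\<lambda>j::int. 2 * nat (j * (j + 1) div 2)"
  let ?v = "\<lambda>j. alt j * (2 * j + 1)"
  have "6 * (qderiv odd_minus * euler 2 ^ 4) = 2 * (3 * (qderiv (euler 1) * euler 2 ^ 3) - euler 1 * qderiv (euler 2 ^ 3))"
    unfolding qderiv_odd_minus_5 by simp
  also have "\<dots> = 3 * (qderiv (euler 1) * (2 * euler 2 ^ 3)) - euler 1 * qderiv (2 * euler 2 ^ 3)"
    unfolding qderiv_double by (simp only: algebra_simps)
  also have "\<dots> = of_int 3 * (qderiv (theta alt ?e) * theta ?v ?d) - theta alt ?e * qderiv (theta ?v ?d)"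
    unfolding jacobi_cube[OF zero_less_numeral] pentagonal_number_theorem[OF zero_less_one] by simp
  finally have eq: "6 * (qderiv odd_minus * euler 2 ^ 4) $ n = (\<Sum>(i, j) | ?e i + ?d j = n. (3 * int (?e i) - int (?d j)) * (alt i * ?v j))"
    unfolding numeral_mult_nth[symmetric]
    by (simp only: qderiv_theta_bracket_nth[OF finite_fibres(3)[OF zero_less_one] finite_fibres(2)[OF zero_less_numeral]])
  have "5 dvd (\<Sum>(i, j) | ?e i + ?d j = n. (3 * int (?e i) - int (?d j)) * (alt i * ?v j))"
  proof (rule dvd_sum)
    fix x assume "x \<in> {(i, j). ?e i + ?d j = n}"
    then obtain i j where x: "x = (i, j)" and n: "?e i + ?d j = n"
      by blast
    define u v where "u = int (?e i)" and "v = int (?d j)"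
    have E: "2 * u = i * (3 * i + 1)"
      unfolding u_def mult_1 by (rule int_pentagonal)
    have D: "v = j * (j + 1)"
      unfolding v_def of_nat_mult of_nat_numeral by (rule int_half_consecutive)
    have "5 dvd 2 * int n" using assms by presburger
    also have "2 * int n = 2 * u + 2 * v"
      unfolding n[symmetric] of_nat_add u_def v_def by (rule distrib_left)
    finally have "5 dvd (3 * (i * (3 * i + 1)) - 2 * (j * (j + 1))) * (2 * j + 1)"
      unfolding E D by (rule dvd_5_quadratic)
    also have "(3 * (i * (3 * i + 1)) - 2 * (j * (j + 1))) * (2 * j + 1) = 2 * ((3 * u - v) * (2 * j + 1))"
      unfolding E[symmetric] D[symmetric] by (simp add: algebra_simps)
    finally have "5 dvd (3 * u - v) * (2 * j + 1)"
      by (simp add: coprime_dvd_mult_right_iff)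
    then have "5 dvd (3 * u - v) * (2 * j + 1) * (alt i * alt j)"
      by (rule dvd_mult2)
    then show "5 dvd (case x of (i, j) \<Rightarrow> (3 * int (?e i) - int (?d j)) * (alt i * ?v j))"
      unfolding x prod.case u_def v_def by (simp only: mult_ac)
  qed
  then have "5 dvd 6 * (qderiv odd_minus * euler 2 ^ 4) $ n"
    unfolding eq .
  then have "5 dvd (qderiv odd_minus * euler 2 ^ 4) $ n"
    by presburger
  then show ?thesis by simp
qed

text \<open>
  The bracket is taken with \<open>2 E\<^sub>1\<^sup>3\<close>; the resulting factor 10 is prime to 7.
\<close>

lemma dvd_7_nth:
  assumes "n mod 7 = 0 \<or> n mod 7 = 2"
  shows "int 7 dvd (qderiv odd_minus * euler 2 ^ (7 - 1)) $ n"
proof -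
  let ?e = "\<lambda>i::int. 1 * nat (i * (i + 1) div 2)" and ?d = "\<lambda>j::int. nat (j * (3 * j + 2))"
  let ?w = "\<lambda>i. alt i * (2 * i + 1)" and ?v = "\<lambda>j. alt j * (3 * j + 1)"
  have "10 * (qderiv odd_minus * euler 2 ^ 6) = 2 * (qderiv (euler 1 ^ 3) * octagonal_theta - euler 1 ^ 3 * qderiv octagonal_theta)"
    unfolding qderiv_odd_minus_7 by simp
  also have "\<dots> = qderiv (2 * euler 1 ^ 3) * octagonal_theta - (2 * euler 1 ^ 3) * qderiv octagonal_theta"
    unfolding qderiv_double by (simp only: algebra_simps)
  also have "\<dots> = of_int 1 * (qderiv (theta ?w ?e) * theta ?v ?d) - theta ?w ?e * qderiv (theta ?v ?d)"
    unfolding jacobi_cube[OF zero_less_one] octagonal_theta_def by simp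
  finally have eq: "10 * (qderiv odd_minus * euler 2 ^ 6) $ n = (\<Sum>(i, j) | ?e i + ?d j = n. (1 * int (?e i) - int (?d j)) * (?w i * ?v j))"
    unfolding numeral_mult_nth[symmetric]
    by (simp only: qderiv_theta_bracket_nth[OF finite_fibres(2)[OF zero_less_one] finite_fibres(4)[OF zero_less_one]])
  have "7 dvd (\<Sum>(i, j) | ?e i + ?d j = n. (1 * int (?e i) - int (?d j)) * (?w i * ?v j))"
  proof (rule dvd_sum)
    fix x assume "x \<in> {(i, j). ?e i + ?d j = n}"
    then obtain i j where x: "x = (i, j)" and n: "?e i + ?d j = n"
      by blast
    define u v where "u = int (?e i)" and "v = int (?d j)"
    have E: "2 * u = i * (i + 1)"
      unfolding u_def mult_1 by (rule int_half_consecutive)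
    have D: "v = j * (3 * j + 2)"
      unfolding v_def by (rule int_octagonal)
    have "7 dvd 2 * int n \<or> 7 dvd 2 * int n - 4" using assms by presburger
    also have "2 * int n = 2 * u + 2 * v"
      unfolding n[symmetric] of_nat_add u_def v_def by (rule distrib_left)
    finally have "7 dvd (i * (i + 1) - 2 * (j * (3 * j + 2))) * ((2 * i + 1) * (3 * j + 1))"
      unfolding E D by (rule dvd_7_quadratic)
    also have "(i * (i + 1) - 2 * (j * (3 * j + 2))) * ((2 * i + 1) * (3 * j + 1))
        = 2 * ((1 * u - v) * ((2 * i + 1) * (3 * j + 1)))"
      unfolding E[symmetric] D[symmetric] by (simp add: algebra_simps)
    finally have "7 dvd (1 * u - v) * ((2 * i + 1) * (3 * j + 1))"
      by (simp add: coprime_dvd_mult_right_iff)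
    then have "7 dvd (1 * u - v) * ((2 * i + 1) * (3 * j + 1)) * (alt i * alt j)"
      by (rule dvd_mult2)
    then show "7 dvd (case x of (i, j) \<Rightarrow> (1 * int (?e i) - int (?d j)) * (?w i * ?v j))"
      unfolding x prod.case u_def v_def by (simp only: mult_ac)
  qed
  then have "7 dvd 10 * (qderiv odd_minus * euler 2 ^ 6) $ n"
    unfolding eq .
  then have "7 dvd (qderiv odd_minus * euler 2 ^ 6) $ n"
    by presburger
  then show ?thesis by simp
qed

theorem theorem1p12:
  fixes n :: nat
  shows "[SODO (5 * n) = 0] (mod 5) \<and> [SODO (7 * n) = 0] (mod 7) \<and> [SODO (7 * n + 2) = 0] (mod 7)"
proof (intro conjI)
  show "[SODO (5 * n) = 0] (mod 5)"
    by (rule dvd_SODO[where r = 0, OF _ dvd_5_nth]) auto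
  show "[SODO (7 * n) = 0] (mod 7)"
    by (rule dvd_SODO[where r = 0, OF _ dvd_7_nth]) auto
  show "[SODO (7 * n + 2) = 0] (mod 7)"
    by (rule dvd_SODO[where r = 2, OF _ dvd_7_nth]) (simp, simp, presburger)
qed

end
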